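(* Let $A$ be an infinite abelian group and $T=\mathrm{Th}(A)$ in the language $\{0,+\}$. The following are equivalent: (1) $\mathrm{vc}^T(1)<\infty$; (2) $\mathrm{vc}^T(m)<\infty$ for every $m$; (3) there is some $d$ such that $\mathrm{vc}^T(m)\le dm$ for every $m$; (4) there are only finitely many primes $p$ which are singular for $A$, and for every prime $p$ the set $U_{\ge\aleph_0}(p;A)$ is finite.
   Context: For a partitioned formula $\varphi(x;y)$ the shatter function $\pi_\varphi(t)$ is the maximal number of subsets of a $t$-element set $S\subseteq A^{|x|}$ of the form $S\cap\varphi(A^{|x|};b)$; its VC density $\mathrm{vc}(\varphi)=\inf\{r\ge0:\pi_\varphi(t)=O(t^r)\}$ (or $\infty$). The VC density function is $\mathrm{vc}^T(n):=\sup\{\mathrm{vc}(\varphi):\varphi(x;y)\text{ with }|y|=n\}$. A prime $p$ is singular for $A$ if $A[p]=\{a:pa=0\}$ or $A/pA$ is infinite. $U(p,i;A):=|(p^iA)[p]/(p^{i+1}A)[p]|$ where $(p^iA)[p]=\{a\in p^iA: pa=0\}$, and $U_{\ge\aleph_0}(p;A)=\{i\ge0: U(p,i;A)\text{ infinite}\}$. *)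

theory Defs
  imports Complex_Main "HOL-Library.Landau_Symbols" "HOL-Library.Extended_Real"
    "HOL-Computational_Algebra.Primes"
begin

text \<open>
  The abelian group \<open>A\<close> is a type \<open>'a :: ab_group_add\<close>; notions that depend on \<open>A\<close> only take an
  argument of type \<open>'a itself\<close>.
\<close>

subsection \<open>First-order formulas in the language of 0 and +\<close>

datatype trm = Var nat | Zero | Plus trm trm

datatype fm = Eq trm trm | Neg fm | Conj fm fm | Ex nat fm

primrec trm_vars :: "trm \<Rightarrow> nat set" where
  "trm_vars (Var i) = {i}"
| "trm_vars Zero = {}"
| "trm_vars (Plus s t) = trm_vars s \<union> trm_vars t"

primrec free_vars :: "fm \<Rightarrow> nat set" where
  "free_vars (Eq s t) = trm_vars s \<union> trm_vars t"
| "free_vars (Neg \<phi>) = free_vars \<phi>"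
| "free_vars (Conj \<phi> \<psi>) = free_vars \<phi> \<union> free_vars \<psi>"
| "free_vars (Ex i \<phi>) = free_vars \<phi> - {i}"

primrec trm_val :: "(nat \<Rightarrow> 'a::ab_group_add) \<Rightarrow> trm \<Rightarrow> 'a" where
  "trm_val e (Var i) = e i"
| "trm_val e Zero = 0"
| "trm_val e (Plus s t) = trm_val e s + trm_val e t"

primrec sat :: "(nat \<Rightarrow> 'a::ab_group_add) \<Rightarrow> fm \<Rightarrow> bool" where
  "sat e (Eq s t) \<longleftrightarrow> trm_val e s = trm_val e t"
| "sat e (Neg \<phi>) \<longleftrightarrow> \<not> sat e \<phi>"
| "sat e (Conj \<phi> \<psi>) \<longleftrightarrow> sat e \<phi> \<and> sat e \<psi>"
| "sat e (Ex i \<phi>) \<longleftrightarrow> (\<exists>a. sat (e(i := a)) \<phi>)"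


subsection \<open>VC density\<close>

text \<open>
  A partitioned formula \<open>\<phi>(x;y)\<close> with \<open>|x| = k\<close> and \<open>|y| = n\<close> is a formula \<open>\<phi>\<close> together with \<open>k\<close> and
  \<open>n\<close>, where \<open>x\<close> consists of the variables \<open>0, \<dots>, k - 1\<close>, \<open>y\<close> of the variables \<open>k, \<dots>, k + n - 1\<close>,
  and all free variables of \<open>\<phi>\<close> are among these. A tuple in \<open>A\<^sup>k\<close> is a list of length \<open>k\<close>. Values of
  the valuation \<open>(!) (a @ b)\<close> outside the list are irrelevant, as \<open>\<phi>\<close> has no further free variables.
\<close>

definition tuples :: "nat \<Rightarrow> 'a list set" where
  "tuples k = {a. length a = k}"

definition partitioned :: "fm \<Rightarrow> nat \<Rightarrow> nat \<Rightarrow> bool" where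
  "partitioned \<phi> k n \<longleftrightarrow> free_vars \<phi> \<subseteq> {..<k + n}"

definition def_set :: "fm \<Rightarrow> nat \<Rightarrow> 'a::ab_group_add list \<Rightarrow> 'a list set" where
  "def_set \<phi> k b = {a \<in> tuples k. sat ((!) (a @ b)) \<phi>}"

text \<open>
  The supremum is over a set of numbers bounded by \<open>2 ^ t\<close>, hence a maximum whenever \<open>A\<^sup>k\<close> has a
  \<open>t\<close>-element subset; otherwise it is \<open>0\<close>. For infinite \<open>A\<close> the latter happens only if \<open>k = 0\<close>
  and \<open>t > 1\<close>.
\<close>

definition shatter_fun :: "'a::ab_group_add itself \<Rightarrow> fm \<Rightarrow> nat \<Rightarrow> nat \<Rightarrow> nat \<Rightarrow> nat" where
  "shatter_fun TYPE('a) \<phi> k n t =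
     (SUP S\<in>{S :: 'a list set. S \<subseteq> tuples k \<and> finite S \<and> card S = t}.
        card ((\<lambda>b. S \<inter> def_set \<phi> k b) ` tuples n))"

text \<open>In \<^typ>\<open>ereal\<close> the infimum of the empty set is \<open>\<infinity>\<close>.\<close>

definition vc_density :: "'a::ab_group_add itself \<Rightarrow> fm \<Rightarrow> nat \<Rightarrow> nat \<Rightarrow> ereal" where
  "vc_density TYPE('a) \<phi> k n =
     (INF r\<in>{r :: real. 0 \<le> r \<and>
          (\<lambda>t. real (shatter_fun TYPE('a) \<phi> k n t)) \<in> O(\<lambda>t. real t powr r)}. ereal r)"

text \<open>
  The VC density function of \<open>Th(A)\<close>, computed in \<open>A\<close>: shatter functions of partitioned formulas
  depend only on the theory of \<open>A\<close>.
\<close>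

definition vc_fun :: "'a::ab_group_add itself \<Rightarrow> nat \<Rightarrow> ereal" where
  "vc_fun TYPE('a) n = (SUP (\<phi>, k)\<in>{(\<phi>, k). partitioned \<phi> k n}. vc_density TYPE('a) \<phi> k n)"


subsection \<open>Singular primes and Ulm invariants\<close>

definition nsmul :: "nat \<Rightarrow> 'a::ab_group_add \<Rightarrow> 'a" where
  "nsmul n a = (\<Sum>i<n. a)"

definition torsion_part :: "nat \<Rightarrow> 'a::ab_group_add set \<Rightarrow> 'a set" where
  "torsion_part p H = {a \<in> H. nsmul p a = 0}"

text \<open>The quotient \<open>H / K\<close> of subgroups \<open>K \<subseteq> H\<close>, as a set of cosets.\<close>

definition cosets :: "'a::ab_group_add set \<Rightarrow> 'a set \<Rightarrow> 'a set set" where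
  "cosets H K = (\<lambda>a. (+) a ` K) ` H"

definition singular_prime :: "'a::ab_group_add itself \<Rightarrow> nat \<Rightarrow> bool" where
  "singular_prime TYPE('a) p \<longleftrightarrow> prime p \<and>
     (infinite (torsion_part p (UNIV :: 'a set)) \<or>
      infinite (cosets (UNIV :: 'a set) (range (nsmul p))))"

text \<open>The set \<open>U\<^sub>\<ge>\<^sub>\<aleph>\<^sub>0(p; A)\<close> of those \<open>i\<close> for which \<open>U(p, i; A) = |(p\<^sup>iA)[p] / (p\<^sup>i\<^sup>+\<^sup>1A)[p]|\<close> is infinite.\<close>

definition U_infinite :: "'a::ab_group_add itself \<Rightarrow> nat \<Rightarrow> nat set" where
  "U_infinite TYPE('a) p =
     {i. infinite (cosets (torsion_part p (range (nsmul (p ^ i) :: 'a \<Rightarrow> 'a)))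
                          (torsion_part p (range (nsmul (p ^ (i + 1)) :: 'a \<Rightarrow> 'a))))}"

end

theory Submission
  imports Defs "HOL-Library.Function_Algebras" "HOL-Library.FuncSet" "HOL-Library.Infinite_Set"
begin

text \<open>
  By Baur-Monk quantifier elimination every formula \<open>\<phi>(x;y)\<close> is a Boolean combination of
  conditions \<open>(x, y) \<in> H\<close>, where \<open>H\<close> is a subgroup given by finitely many divisibilities
  \<open>d | f(x, y)\<close> of integral linear forms. Over a finite set \<open>S\<close> of values of \<open>x\<close>, a tuple \<open>y\<close> is
  described by the cosets of such subgroups containing it. If every finite intersection of these
  subgroups of \<open>A\<^sup>m\<close> agrees up to finite index with the intersection of at most \<open>D\<close> of them, then
  \<open>D\<close> cosets and a bounded choice suffice, and the shatter function is \<open>O(t\<^sup>D)\<close>. The optimal \<open>D\<close>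
  is subadditive along the fibration of \<open>A\<^sup>m\<close> over \<open>A\<^sup>m\<^sup>-\<^sup>1\<close> with fibre \<open>A\<close>, hence at most \<open>m\<close> times
  its value for \<open>m = 1\<close>. In \<open>A\<close> itself, up to finite index, only torsion subgroups \<open>A[b]\<close> and, for
  singular \<open>p\<close>, the subgroups \<open>p\<^sup>nA + A[p\<^sup>l]\<close> matter; condition (4) leaves finitely many \<open>p\<close>, and
  finitely many \<open>l\<close> for each of them.

  Conversely, if (4) fails, there are arbitrarily long families of subgroups \<open>H\<^sub>s\<close> of the form
  \<open>{x. d | bx}\<close> such that each \<open>H\<^sub>s\<close> meets the intersection of the others in a subgroup of infinite
  index. A formula with selector variables that says \<open>y - x \<in> H\<^sub>s\<close> then realises all choices of one
  coset for each \<open>s\<close>, so its VC density is at least the length of the family.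
\<close>

subsection \<open>Integer multiples\<close>

text \<open>Integer scalars make \<open>A\<close> a module over the integers, so that the library's
  algebra of modules applies. Building them on \<open>nsmul\<close> keeps the link to the notions in
  the statement.\<close>

definition zs :: "int \<Rightarrow> 'a \<Rightarrow> 'a::ab_group_add" where
  "zs n a = (if 0 \<le> n then nsmul (nat n) a else - nsmul (nat (- n)) a)"

lemma nsmul_0 [simp]: "nsmul 0 a = 0"
  and nsmul_Suc [simp]: "nsmul (Suc n) a = nsmul n a + a"
  by (simp_all add: nsmul_def)

lemma zs_int: "zs (int n) a = nsmul n a"
  by (simp add: zs_def)

lemma zs_add1: "zs (n + 1) a = zs n a + a"
proof (cases "0 \<le> n")
  case True
  then show ?thesis by (simp add: zs_def nat_add_distrib)
next
  case False
  then obtain m where "n = - int (Suc m)"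
    using negD[of n] by auto
  then show ?thesis by (cases "m = 0") (auto simp: zs_def nat_diff_distrib nat_add_distrib)
qed

interpretation zs: module "zs :: int \<Rightarrow> 'a \<Rightarrow> 'a::ab_group_add"
proof
  have sub1: "zs (n - 1) a = zs n a - a" for n and a :: 'a
    using zs_add1[of "n - 1" a] by simp
  have zero: "zs 0 a = 0" for a :: 'a
    by (simp add: zs_def)
  show add: "zs (m + n) a = zs m a + zs n a" for m n and a :: 'a
  proof (induction n rule: int_induct[where k = 0])
    case base
    then show ?case by (simp add: zero)
  next
    case (step1 i)
    then show ?case using zs_add1[of "m + i" a] by (simp add: zs_add1 add.assoc)
  next
    case (step2 i)
    then show ?case using sub1[of "m + i" a] by (simp add: sub1 add_diff_eq)
  qed
  show "zs n (a + b) = zs n a + zs n b" for n and a b :: 'a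
    by (induction n rule: int_induct[where k = 0]) (simp_all add: zs_add1 sub1 zero)
  have one: "zs 1 a = a" for a :: 'a
    by (simp add: zs_def)
  then show "zs 1 a = a" for a :: 'a .
  show "zs m (zs n a) = zs (m * n) a" for m n and a :: 'a
  proof (induction m rule: int_induct[where k = 0])
    case base
    then show ?case by (simp add: zs_def)
  next
    case (step1 i)
    then show ?case by (simp add: distrib_right add one)
  next
    case (step2 i)
    have "zs (i * n) a = zs ((i - 1) * n) a + zs n a"
      by (metis add diff_add_cancel distrib_right mult_1)
    then show ?case using step2 by (simp add: sub1 one)
  qed
qed

lemma zs_mult_commute: "zs m (zs n a) = zs n (zs m a)"
  by (simp add: mult.commute)


subsection \<open>Covering by finitely many translates\<close>

definition subgrp :: "'a::ab_group_add set \<Rightarrow> bool" where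
  "subgrp H \<longleftrightarrow> 0 \<in> H \<and> (\<forall>x\<in>H. \<forall>y\<in>H. x - y \<in> H)"

text \<open>For subgroups this says that \<open>X \<inter> Y\<close> has finite index in
  \<open>X\<close>. The translating elements need not lie in \<open>X\<close>, and \<open>Y\<close>
  need not be contained in \<open>X\<close>.\<close>

definition almost_in :: "'a::ab_group_add set \<Rightarrow> 'a set \<Rightarrow> bool" (infix "\<lesssim>" 50) where
  "X \<lesssim> Y \<longleftrightarrow> (\<exists>F. finite F \<and> (\<forall>x\<in>X. \<exists>f\<in>F. x - f \<in> Y))"

lemma almost_inI: "finite F \<Longrightarrow> (\<And>x. x \<in> X \<Longrightarrow> \<exists>f\<in>F. x - f \<in> Y) \<Longrightarrow> X \<lesssim> Y"
  unfolding almost_in_def by blast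

lemma subgrp_0: "subgrp H \<Longrightarrow> 0 \<in> H"
  and subgrp_diff: "subgrp H \<Longrightarrow> x \<in> H \<Longrightarrow> y \<in> H \<Longrightarrow> x - y \<in> H"
  by (auto simp: subgrp_def)

lemma subgrp_uminus: "subgrp H \<Longrightarrow> x \<in> H \<Longrightarrow> - x \<in> H"
  using subgrp_diff[of H 0 x] by (simp add: subgrp_0)

lemma subgrp_add: "subgrp H \<Longrightarrow> x \<in> H \<Longrightarrow> y \<in> H \<Longrightarrow> x + y \<in> H"
  using subgrp_diff[of H x "- y"] by (simp add: subgrp_uminus)

lemma subgrp_Int: "subgrp H \<Longrightarrow> subgrp K \<Longrightarrow> subgrp (H \<inter> K)"
  by (auto simp: subgrp_def)

lemma subgrp_INT: "(\<And>i. i \<in> I \<Longrightarrow> subgrp (H i)) \<Longrightarrow> subgrp (\<Inter>i\<in>I. H i)"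
  by (auto simp: subgrp_def)

lemma subgrp_add_cancel: "subgrp H \<Longrightarrow> y \<in> H \<Longrightarrow> x + y \<in> H \<longleftrightarrow> x \<in> H"
  by (metis add_diff_cancel_right' subgrp_add subgrp_diff)

lemma almost_subset: "X \<subseteq> Y \<Longrightarrow> X \<lesssim> Y"
  unfolding almost_in_def by (intro exI[of _ "{0}"]) auto

lemma almost_trans:
  assumes "X \<lesssim> Y" "Y \<lesssim> Z"
  shows "X \<lesssim> Z"
proof -
  obtain F G where F: "finite F" "\<forall>x\<in>X. \<exists>f\<in>F. x - f \<in> Y"
    and G: "finite G" "\<forall>y\<in>Y. \<exists>g\<in>G. y - g \<in> Z"
    using assms unfolding almost_in_def by blast
  have "\<exists>h\<in>(\<lambda>(f, g). f + g) ` (F \<times> G). x - h \<in> Z" if x: "x \<in> X" for x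
  proof -
    obtain f where f: "f \<in> F" "x - f \<in> Y" using bspec[OF F(2) x] by blast
    moreover obtain g where "g \<in> G" "x - f - g \<in> Z" using bspec[OF G(2) f(2)] by blast
    ultimately show ?thesis by (intro bexI[of _ "f + g"]) (auto simp: diff_diff_eq)
  qed
  then show ?thesis using F(1) G(1) by (intro almost_inI[rotated]) (assumption, simp)
qed

lemma almost_mono: "X \<lesssim> Y \<Longrightarrow> X' \<subseteq> X \<Longrightarrow> Y \<subseteq> Y' \<Longrightarrow> X' \<lesssim> Y'"
  by (meson almost_subset almost_trans)

lemma almost_finite: "finite X \<Longrightarrow> 0 \<in> Y \<Longrightarrow> X \<lesssim> Y"
  unfolding almost_in_def by (intro exI[of _ X]) force

text \<open>A translate of \<open>Y\<close> and a translate of \<open>Z\<close> that meet do so in a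
  single coset of \<open>Y \<inter> Z\<close>; finitely many pairs of translates have to be
  considered.\<close>

lemma almost_Int:
  assumes "X \<lesssim> Y" "X \<lesssim> Z" "subgrp Y" "subgrp Z"
  shows "X \<lesssim> Y \<inter> Z"
proof -
  obtain F G where F: "finite F" "\<forall>x\<in>X. \<exists>f\<in>F. x - f \<in> Y"
    and G: "finite G" "\<forall>x\<in>X. \<exists>g\<in>G. x - g \<in> Z"
    using assms unfolding almost_in_def by blast
  \<comment> \<open>A common point of the two translates; its value is arbitrary for pairs that do
    not meet, and such pairs never occur below.\<close>
  define r where "r = (\<lambda>(f, g). SOME x. x - f \<in> Y \<and> x - g \<in> Z)"
  have "\<exists>h\<in>r ` (F \<times> G). x - h \<in> Y \<inter> Z" if x: "x \<in> X" for x
  proof -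
    obtain f g where fg: "f \<in> F" "g \<in> G" "x - f \<in> Y" "x - g \<in> Z"
      using bspec[OF F(2) x] bspec[OF G(2) x] by blast
    then have "r (f, g) - f \<in> Y \<and> r (f, g) - g \<in> Z"
      unfolding r_def by simp (rule someI[of _ x], simp)
    then have "x - r (f, g) \<in> Y \<inter> Z"
      using subgrp_diff[OF assms(3), of "x - f" "r (f, g) - f"]
        subgrp_diff[OF assms(4), of "x - g" "r (f, g) - g"] fg by simp
    then show ?thesis using fg by blast
  qed
  then show ?thesis using F(1) G(1) by (intro almost_inI[rotated]) (assumption, simp)
qed

lemma almost_INT:
  assumes "finite I" "\<And>i. i \<in> I \<Longrightarrow> subgrp (Y i)" "\<And>i. i \<in> I \<Longrightarrow> X \<lesssim> Y i"
  shows "X \<lesssim> (\<Inter>i\<in>I. Y i)"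
  using assms
proof (induction I)
  case empty
  then show ?case by (simp add: almost_subset)
next
  case (insert i I)
  then show ?case by (simp add: almost_Int subgrp_INT)
qed

lemma coset_eq_iff:
  assumes "subgrp (K :: 'a::ab_group_add set)"
  shows "(+) a ` K = (+) b ` K \<longleftrightarrow> a - b \<in> K"
proof
  assume "(+) a ` K = (+) b ` K"
  moreover have "a \<in> (+) a ` K" using subgrp_0[OF assms] by force
  ultimately obtain k where "a = b + k" "k \<in> K" by blast
  then show "a - b \<in> K" by simp
next
  assume ab: "a - b \<in> K"
  have "(+) a ` K \<subseteq> (+) b ` K" if "a - b \<in> K" for a b
  proof
    fix x assume "x \<in> (+) a ` K"
    then obtain k where "x = b + ((a - b) + k)" "k \<in> K" by auto
    then show "x \<in> (+) b ` K" using subgrp_add[OF assms that] by blast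
  qed
  then show "(+) a ` K = (+) b ` K"
    using ab subgrp_uminus[OF assms ab] by (simp add: subset_antisym)
qed

lemma finite_cosetsD:
  assumes "finite (cosets H K)" "subgrp K"
  shows "H \<lesssim> K"
proof -
  obtain F where F: "F \<subseteq> H" "finite F" "cosets H K = (\<lambda>a. (+) a ` K) ` F"
    using assms(1) unfolding cosets_def by (metis (no_types, lifting) finite_subset_image subset_refl)
  have "\<exists>f\<in>F. x - f \<in> K" if "x \<in> H" for x
  proof -
    have "(+) x ` K \<in> (\<lambda>a. (+) a ` K) ` F" using that F(3) by (auto simp: cosets_def)
    then show ?thesis using coset_eq_iff[OF assms(2)] by blast
  qed
  then show ?thesis using F(2) by (intro almost_inI)
qed

lemma infinite_cosetsD:
  assumes "infinite (cosets H K)" "subgrp K"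
  obtains c :: "nat \<Rightarrow> 'a::ab_group_add"
    where "\<And>r. c r \<in> H" "\<And>r r'. r \<noteq> r' \<Longrightarrow> c r - c r' \<notin> K"
proof -
  obtain f :: "nat \<Rightarrow> 'a set" where f: "inj f" "range f \<subseteq> cosets H K"
    using infinite_countable_subset[OF assms(1)] by blast
  then have "\<forall>r. \<exists>a. a \<in> H \<and> f r = (+) a ` K"
    unfolding cosets_def by blast
  then obtain c where "\<And>r. c r \<in> H \<and> f r = (+) (c r) ` K" by metis
  then show ?thesis using that f(1) coset_eq_iff[OF assms(2)] by (metis injD)
qed


subsection \<open>Neumann's lemma\<close>

text \<open>Induction on the number of subgroups. If the translates of \<open>K\<close> in the
  covering miss some \<open>g\<close> in \<open>G\<close>, then the coset of \<open>g\<close> modulo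
  \<open>K\<close> is covered by the other subgroups alone. Moving this covering onto the finitely
  many translates of \<open>K\<close> removes \<open>K\<close> from the covering.\<close>

lemma neumann_exists:
  assumes "finite \<K>" "\<forall>K\<in>\<K>. subgrp K" "subgrp G" "finite F"
    and "\<forall>x\<in>G. \<exists>K\<in>\<K>. \<exists>f\<in>F. x - f \<in> K"
  shows "\<exists>K\<in>\<K>. G \<lesssim> K"
  using assms
proof (induction arbitrary: F)
  case empty
  then show ?case using subgrp_0 by blast
next
  case (insert K \<K>)
  show ?case
  proof (rule ccontr)
    assume contra: "\<not> ?thesis"
    then have "\<not> G \<lesssim> K" by simp
    then obtain g where g: "g \<in> G" "\<And>f. f \<in> F \<Longrightarrow> g - f \<notin> K"
      using insert.prems(3) unfolding almost_in_def by blast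
    have subK: "subgrp K" using insert by simp
    define r where "r f = (SOME x. x \<in> G \<and> x - f \<in> K)" for f
    define F' where "F' = F \<union> (\<lambda>(f, f'). r f - g + f') ` (F \<times> F)"
    have "\<exists>K\<in>\<K>. \<exists>f\<in>F'. x - f \<in> K" if x: "x \<in> G" for x
    proof (cases "\<exists>f\<in>F. x - f \<in> K")
      case True
      then obtain f where f: "f \<in> F" "x - f \<in> K" by blast
      then have r: "r f \<in> G \<and> r f - f \<in> K"
        unfolding r_def using x someI[of "\<lambda>x. x \<in> G \<and> x - f \<in> K" x] by simp
      have k: "x - r f \<in> K"
        using subgrp_diff[OF subK f(2) conjunct2[OF r]] by simp
      \<comment> \<open>This is \<open>x\<close> moved from the coset of \<open>r f\<close> into the
        coset of \<open>g\<close>, where no translate of \<open>K\<close> from the covering can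
        reach it.\<close>
      have "g + (x - r f) \<in> G"
        using g(1) r x by (intro subgrp_add subgrp_diff insert.prems(2)) auto
      then obtain K' f' where K': "K' \<in> insert K \<K>" "f' \<in> F" "g + (x - r f) - f' \<in> K'"
        using bspec[OF insert.prems(4)] by blast
      have eq: "x - (r f - g + f') = g + (x - r f) - f'" by simp
      have "K' \<noteq> K"
        using K'(3) g(2)[OF K'(2)] subgrp_add_cancel[OF subK k, of "g - f'"]
        by (auto simp: algebra_simps)
      then have K'K: "K' \<in> \<K>" using K'(1) by simp
      have "r f - g + f' \<in> F'" using f K' by (auto simp: F'_def)
      moreover have "x - (r f - g + f') \<in> K'" using K'(3) by (simp only: eq)
      ultimately have "\<exists>f\<in>F'. x - f \<in> K'" by (rule bexI[where x = "r f - g + f'", rotated])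
      then show ?thesis using K'K by (rule bexI)
    next
      case False
      then show ?thesis using insert.prems(4)[rule_format, OF x] by (auto simp: F'_def)
    qed
    moreover have "finite F'" using insert.prems(3) by (simp add: F'_def)
    ultimately have "\<exists>K\<in>\<K>. G \<lesssim> K"
      using insert.prems(1,2) by (intro insert.IH[of F']) auto
    then show False using contra by blast
  qed
qed

lemma neumann_drop:
  assumes fin: "finite I" and sub: "subgrp G" "\<And>i. i \<in> I \<Longrightarrow> subgrp (K i)"
    and cover: "\<And>x. x \<in> G \<Longrightarrow> \<exists>i\<in>I. x - c i \<in> K i" and x: "x \<in> G"
  shows "\<exists>i\<in>I. G \<lesssim> K i \<and> x - c i \<in> K i"
proof (rule ccontr)
  assume contra: "\<not> ?thesis"
  define J where "J = {i \<in> I. G \<lesssim> K i}"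
  define L where "L = G \<inter> (\<Inter>i\<in>J. K i)"
  have L: "subgrp L" "G \<lesssim> L"
    unfolding L_def using fin sub
    by (auto simp: J_def intro!: subgrp_Int subgrp_INT almost_Int[OF almost_subset almost_INT])
  have "\<exists>M\<in>K ` (I - J). \<exists>f\<in>(\<lambda>i. c i - x) ` I. l - f \<in> M" if l: "l \<in> L" for l
  proof -
    have "x + l \<in> G" using x l sub(1) subgrp_add by (auto simp: L_def)
    then obtain i where i: "i \<in> I" "x + l - c i \<in> K i" using cover by metis
    have "i \<notin> J"
    proof
      assume "i \<in> J"
      then have "l \<in> K i" using l by (auto simp: L_def)
      then have "x - c i \<in> K i"
        using i subgrp_add_cancel[of "K i" l "x - c i"] sub by (auto simp: algebra_simps)
      then show False using contra \<open>i \<in> J\<close> by (auto simp: J_def)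
    qed
    moreover have "l - (c i - x) \<in> K i" using i(2) by (simp add: algebra_simps)
    ultimately show ?thesis using i(1) by blast
  qed
  then have "\<exists>M\<in>K ` (I - J). L \<lesssim> M"
    using fin sub by (intro neumann_exists[where F = "(\<lambda>i. c i - x) ` I"] L(1)) auto
  then show False using L(2) almost_trans by (auto simp: J_def)
qed

subsection \<open>Coverings of cosets\<close>

text \<open>Inclusion-exclusion in recursive form: removing one more set subtracts the count for
  \<open>S \<inter> A h\<close>, so the induction hypothesis is used both for \<open>S\<close> and
  for \<open>S \<inter> A h\<close>.\<close>

lemma card_Diff_UN_transfer:
  fixes A A' :: "'h \<Rightarrow> 'b set"
  assumes "finite T" "finite S" "finite S'"
    and "\<And>J. J \<subseteq> T \<Longrightarrow> card (S \<inter> (\<Inter>h\<in>J. A h)) = card (S' \<inter> (\<Inter>h\<in>J. A' h))"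
  shows "card (S - (\<Union>h\<in>T. A h)) = card (S' - (\<Union>h\<in>T. A' h))"
  using assms
proof (induction T arbitrary: S S')
  case empty
  then show ?case using empty(3)[of "{}"] by simp
next
  case (insert h T)
  have split: "card (S - (\<Union>h\<in>insert h T. A h)) = card (S - (\<Union>h\<in>T. A h)) - card (S \<inter> A h - (\<Union>h\<in>T. A h))"
    if "finite S" for S :: "'b set" and A :: "'h \<Rightarrow> 'b set"
  proof -
    have "S - (\<Union>h\<in>insert h T. A h) = (S - (\<Union>h\<in>T. A h)) - (S \<inter> A h - (\<Union>h\<in>T. A h))" by auto
    moreover have "S \<inter> A h - (\<Union>h\<in>T. A h) \<subseteq> S - (\<Union>h\<in>T. A h)" by auto
    ultimately show ?thesis using that by (metis card_Diff_subset finite_Diff finite_Int)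
  qed
  have "card (S - (\<Union>h\<in>T. A h)) = card (S' - (\<Union>h\<in>T. A' h))"
    using insert.prems by (intro insert.IH) auto
  moreover have "card (S \<inter> A h - (\<Union>h\<in>T. A h)) = card (S' \<inter> A' h - (\<Union>h\<in>T. A' h))"
  proof (rule insert.IH)
    show "card (S \<inter> A h \<inter> (\<Inter>h\<in>J. A h)) = card (S' \<inter> A' h \<inter> (\<Inter>h\<in>J. A' h))" if "J \<subseteq> T" for J
      using insert.prems(3)[of "insert h J"] that by (auto simp: Int_assoc)
  qed (use insert.prems in auto)
  ultimately show ?case
    using insert.prems(1,2) by (simp only: split)
qed

definition coset_of :: "'a::ab_group_add set \<Rightarrow> 'a set \<Rightarrow> bool" where
  "coset_of K C \<longleftrightarrow> (\<forall>x\<in>C. \<forall>y. y \<in> C \<longleftrightarrow> y - x \<in> K)"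

lemma coset_ofD: "coset_of K C \<Longrightarrow> x \<in> C \<Longrightarrow> y \<in> C \<longleftrightarrow> y - x \<in> K"
  unfolding coset_of_def by simp

lemma coset_of_Int: "coset_of K C \<Longrightarrow> coset_of L D \<Longrightarrow> coset_of (K \<inter> L) (C \<inter> D)"
  unfolding coset_of_def by (metis IntD1 IntD2 IntI)

lemma coset_of_INT:
  "(\<And>h. h \<in> T \<Longrightarrow> coset_of (K h) (C h)) \<Longrightarrow> coset_of (\<Inter>h\<in>T. K h) (\<Inter>h\<in>T. C h)"
  unfolding coset_of_def INT_iff by (intro ballI allI ball_cong refl) simp

text \<open>Translation by an element of \<open>C\<close> carries the cosets of \<open>L\<close>
  that meet \<open>M\<close> to those that meet \<open>C\<close>, so the count depends on
  \<open>M\<close> only.\<close>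

lemma card_cosets_coset_of:
  assumes "coset_of M C" "C \<noteq> {}"
  shows "card ((\<lambda>x. (+) x ` L) ` C) = card ((\<lambda>x. (+) x ` L) ` M)"
proof -
  obtain c where c: "c \<in> C" using assms(2) by blast
  have C: "C = (+) c ` M"
  proof -
    have "x \<in> (+) c ` M" if "x \<in> C" for x
      using coset_ofD[OF assms(1) c, of x] that by (intro image_eqI[of _ _ "x - c"]) auto
    moreover have "c + y \<in> C" if "y \<in> M" for y
      using coset_ofD[OF assms(1) c, of "c + y"] that by simp
    ultimately show ?thesis by (intro subset_antisym subsetI) auto
  qed
  have "(\<lambda>x. (+) x ` L) ` C = (\<lambda>X. (+) c ` X) ` (\<lambda>x. (+) x ` L) ` M"
    unfolding C image_image by (simp add: add.assoc)
  moreover have "inj_on (\<lambda>X. (+) c ` X) UNIV"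
    by (intro injI) (simp add: inj_image_eq_iff)
  ultimately show ?thesis by (metis card_image inj_on_subset subset_UNIV)
qed

lemma almost_in_finite_cosets:
  assumes "X \<lesssim> L" "subgrp L"
  shows "finite ((\<lambda>x. (+) x ` L) ` X)"
proof -
  obtain F where F: "finite F" "\<forall>x\<in>X. \<exists>f\<in>F. x - f \<in> L"
    using assms(1) unfolding almost_in_def by auto
  have "(\<lambda>x. (+) x ` L) ` X \<subseteq> (\<lambda>x. (+) x ` L) ` F"
  proof
    fix y assume "y \<in> (\<lambda>x. (+) x ` L) ` X"
    then obtain x where x: "x \<in> X" "y = (+) x ` L" by auto
    obtain f where "f \<in> F" "x - f \<in> L" using bspec[OF F(2) x(1)] by auto
    then show "y \<in> (\<lambda>x. (+) x ` L) ` F"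
      using x(2) coset_eq_iff[OF assms(2)] by (intro image_eqI[of _ _ f]) auto
  qed
  then show ?thesis using F(1) by (rule finite_surj[rotated])
qed

text \<open>By Neumann's lemma only the cosets of subgroups of finite index matter for the covering.
  These are unions of cosets of a common subgroup of finite index, and counting the latter by
  inclusion-exclusion needs no information except which intersections are empty.\<close>

lemma coset_cover_transfer:
  fixes C C' :: "'h \<Rightarrow> 'a::ab_group_add set"
  assumes T: "finite T" and K0: "subgrp K0" and K: "\<And>h. h \<in> T \<Longrightarrow> subgrp (K h)"
    and C0: "coset_of K0 C0" and C: "\<And>h. h \<in> T \<Longrightarrow> coset_of (K h) (C h)"
    and C0': "coset_of K0 C0'" and C': "\<And>h. h \<in> T \<Longrightarrow> coset_of (K h) (C' h)"
    and pat: "\<And>J. J \<subseteq> T \<Longrightarrow> C0 \<inter> (\<Inter>h\<in>J. C h) \<noteq> {} \<longleftrightarrow> C0' \<inter> (\<Inter>h\<in>J. C' h) \<noteq> {}"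
    and cover: "C0 \<subseteq> (\<Union>h\<in>T. C h)"
  shows "C0' \<subseteq> (\<Union>h\<in>T. C' h)"
proof (cases "C0 = {}")
  case True
  then show ?thesis using pat[of "{}"] by simp
next
  case False
  then obtain a where a: "a \<in> C0" by blast
  define T' where "T' = {h \<in> T. K0 \<lesssim> K h}"
  \<comment> \<open>Coordinates are centred at \<open>a\<close>, so that \<open>neumann_drop\<close>
    applies to the subgroup \<open>K0\<close> in place of the coset \<open>C0\<close>. For empty
    \<open>C h\<close> the value is meaningless, which is why those \<open>h\<close> are filtered
    out below.\<close>
  define c where "c h = (SOME x. x \<in> C h) - a" for h
  have cC: "y \<in> C h \<longleftrightarrow> y - a - c h \<in> K h" if "h \<in> T" "C h \<noteq> {}" for h y
  proof -
    have "(SOME x. x \<in> C h) \<in> C h" using that(2) by (simp add: some_in_eq)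
    from coset_ofD[OF C[OF that(1)] this, of y] show ?thesis by (simp add: c_def)
  qed
  have cover': "C0 \<subseteq> (\<Union>h\<in>T'. C h)"
  proof
    fix y assume y: "y \<in> C0"
    have "\<exists>i\<in>{h \<in> T. C h \<noteq> {}}. K0 \<lesssim> K i \<and> (y - a) - c i \<in> K i"
    proof (rule neumann_drop)
      fix x assume "x \<in> K0"
      then have "x + a \<in> C0" using coset_ofD[OF C0 a, of "x + a"] by simp
      then obtain h where "h \<in> T" "x + a \<in> C h" using cover by blast
      then show "\<exists>i\<in>{h \<in> T. C h \<noteq> {}}. x - c i \<in> K i"
        using cC[of h "x + a"] by (intro bexI[of _ h]) auto
    qed (use T K0 K y coset_ofD[OF C0 a, of y] in auto)
    then show "y \<in> (\<Union>h\<in>T'. C h)" using cC by (auto simp: T'_def)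
  qed
  define L where "L = K0 \<inter> (\<Inter>h\<in>T'. K h)"
  have subL: "subgrp L"
    unfolding L_def using K0 K by (auto simp: T'_def intro!: subgrp_Int subgrp_INT)
  have K0L: "K0 \<lesssim> L"
    unfolding L_def using T K0 K
    by (auto simp: T'_def intro!: almost_Int[OF almost_subset almost_INT] subgrp_INT)
  define q where "q x = (+) x ` L" for x
  have q_eq: "q x = q y \<longleftrightarrow> x - y \<in> L" for x y
    unfolding q_def using coset_eq_iff[OF subL] .
  have fin_q: "finite (q ` D)" if "coset_of K0 D" for D
  proof (cases "D = {}")
    case False
    then obtain d where "d \<in> D" by blast
    then have "D \<lesssim> K0"
      using coset_ofD[OF that] by (intro almost_inI[of "{d}"]) auto
    then show ?thesis
      unfolding q_def using almost_in_finite_cosets[OF _ subL] K0L almost_trans by blast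
  qed simp
  have q_mem: "x \<in> D" if "q x \<in> q ` D" "coset_of M D" "L \<subseteq> M" for x M D
  proof -
    obtain y where "y \<in> D" "q x = q y" using \<open>q x \<in> q ` D\<close> by blast
    then show ?thesis using q_eq[of x y] that(3) coset_ofD[OF that(2), of y x] by blast
  qed
  have LK: "L \<subseteq> K h" if "h \<in> T'" for h
    using that by (auto simp: L_def)
  have LK0: "L \<subseteq> K0"
    by (auto simp: L_def)
  have q_INT: "q ` D0 \<inter> (\<Inter>h\<in>J. q ` D h) = q ` (D0 \<inter> (\<Inter>h\<in>J. D h))"
    if J: "J \<subseteq> T'" and D: "\<And>h. h \<in> T \<Longrightarrow> coset_of (K h) (D h)" for J D0 D
  proof
    show "q ` D0 \<inter> (\<Inter>h\<in>J. q ` D h) \<subseteq> q ` (D0 \<inter> (\<Inter>h\<in>J. D h))"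
    proof
      fix z assume z: "z \<in> q ` D0 \<inter> (\<Inter>h\<in>J. q ` D h)"
      then obtain x where x: "x \<in> D0" "z = q x" by blast
      have "x \<in> D h" if "h \<in> J" for h
      proof (rule q_mem)
        show "q x \<in> q ` D h" using z x(2) that by blast
        have "h \<in> T'" using that J by blast
        then show "coset_of (K h) (D h)" "L \<subseteq> K h" using D LK by (auto simp: T'_def)
      qed
      then show "z \<in> q ` (D0 \<inter> (\<Inter>h\<in>J. D h))" using x by blast
    qed
  qed blast
  \<comment> \<open>Each side counts the cosets of \<open>L\<close> left uncovered. Corresponding
    intersections are cosets of the same \<open>M\<close> or both empty, hence consist of equally
    many cosets of \<open>L\<close>.\<close>
  have "card (q ` C0 - (\<Union>h\<in>T'. q ` C h)) = card (q ` C0' - (\<Union>h\<in>T'. q ` C' h))"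
  proof (rule card_Diff_UN_transfer)
    fix J assume J: "J \<subseteq> T'"
    have JT: "J \<subseteq> T" using J by (auto simp: T'_def)
    define M where "M = K0 \<inter> (\<Inter>h\<in>J. K h)"
    have M: "coset_of M (C0 \<inter> (\<Inter>h\<in>J. C h))" "coset_of M (C0' \<inter> (\<Inter>h\<in>J. C' h))"
      unfolding M_def using JT C C' by (auto intro!: coset_of_Int coset_of_INT C0 C0')
    have "card (q ` (C0 \<inter> (\<Inter>h\<in>J. C h))) = card (q ` (C0' \<inter> (\<Inter>h\<in>J. C' h)))"
    proof (cases "C0 \<inter> (\<Inter>h\<in>J. C h) = {}")
      case True
      then show ?thesis using pat[OF JT] by simp
    next
      case False
      then show ?thesis
        using pat[OF JT] card_cosets_coset_of[OF M(1)] card_cosets_coset_of[OF M(2)]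
        unfolding q_def by simp
    qed
    then show "card (q ` C0 \<inter> (\<Inter>h\<in>J. q ` C h)) = card (q ` C0' \<inter> (\<Inter>h\<in>J. q ` C' h))"
      using q_INT[OF J C] q_INT[OF J C'] by simp
  qed (use T fin_q C0 C0' in \<open>auto simp: T'_def\<close>)
  moreover have "q ` C0 - (\<Union>h\<in>T'. q ` C h) = {}" using cover' by blast
  ultimately have "q ` C0' - (\<Union>h\<in>T'. q ` C' h) = {}"
    using fin_q[OF C0'] by (metis card.empty card_0_eq finite_Diff)
  show ?thesis
  proof
    fix x assume "x \<in> C0'"
    then have "q x \<in> (\<Union>h\<in>T'. q ` C' h)"
      using \<open>q ` C0' - (\<Union>h\<in>T'. q ` C' h) = {}\<close> by blast
    then obtain h where h: "h \<in> T'" "q x \<in> q ` C' h" by blast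
    then have "x \<in> C' h"
      using LK C' by (intro q_mem[of x "C' h" "K h"]) (auto simp: T'_def)
    then show "x \<in> (\<Union>h\<in>T. C' h)" using h by (auto simp: T'_def)
  qed
qed

subsection \<open>Elimination of unknowns in linear systems\<close>

definition solvable :: "'j set \<Rightarrow> 'k set \<Rightarrow> ('j \<Rightarrow> 'k \<Rightarrow> int) \<Rightarrow> ('j \<Rightarrow> 'a::ab_group_add) \<Rightarrow> bool" where
  "solvable J K C t \<longleftrightarrow> (\<exists>w. \<forall>j\<in>J. (\<Sum>k\<in>K. zs (C j k) (w k)) = t j)"

text \<open>The case \<open>d = 0\<close> is included and expresses an equation.\<close>

definition divisible :: "'j set \<Rightarrow> (int \<times> ('j \<Rightarrow> int)) set \<Rightarrow> ('j \<Rightarrow> 'a::ab_group_add) \<Rightarrow> bool" where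
  "divisible J U t \<longleftrightarrow> (\<forall>(d, u)\<in>U. \<exists>y. zs d y = (\<Sum>j\<in>J. zs (u j) (t j)))"

definition reducible :: "'a::ab_group_add itself \<Rightarrow> 'j set \<Rightarrow> 'k set \<Rightarrow> ('j \<Rightarrow> 'k \<Rightarrow> int) \<Rightarrow> bool" where
  "reducible TYPE('a) J K C \<longleftrightarrow>
     (\<exists>U. finite U \<and> (\<forall>t :: 'j \<Rightarrow> 'a. solvable J K C t \<longleftrightarrow> divisible J U t))"

text \<open>An integral combination of the modified right-hand sides \<open>t j - q j * t i\<close>
  is again an integral combination of the original ones; only the coefficient of \<open>t i\<close>
  changes.\<close>

lemma reducible_pullback:
  fixes C C' :: "'j \<Rightarrow> 'k \<Rightarrow> int"
  assumes J: "finite J" "i \<in> J" and U0: "finite U0"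
    and red: "reducible TYPE('a::ab_group_add) J K C'"
    and eq: "\<And>t :: 'j \<Rightarrow> 'a. solvable J K C t \<longleftrightarrow>
      divisible J U0 t \<and> solvable J K C' (\<lambda>j. t j - zs (q j) (t i))"
  shows "reducible TYPE('a) J K C"
proof -
  obtain U where U: "finite U" "\<And>t :: 'j \<Rightarrow> 'a. solvable J K C' t \<longleftrightarrow> divisible J U t"
    using red unfolding reducible_def by blast
  define pull where
    "pull u = (\<lambda>j. u j - (if j = i then \<Sum>l\<in>J. u l * q l else 0))" for u
  have pull: "(\<Sum>j\<in>J. zs (pull u j) (t j)) = (\<Sum>j\<in>J. zs (u j) (t j - zs (q j) (t i)))"
    for u and t :: "'j \<Rightarrow> 'a"
  proof -
    have "(\<Sum>j\<in>J. zs (if j = i then \<Sum>l\<in>J. u l * q l else 0) (t j)) = zs (\<Sum>l\<in>J. u l * q l) (t i)"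
      using J by (simp add: if_distrib[of "\<lambda>n. zs n _"] cong: if_cong)
    then show ?thesis
      by (simp add: pull_def zs.scale_left_diff_distrib zs.scale_right_diff_distrib sum_subtractf
          zs.scale_sum_left)
  qed
  have "divisible J U (\<lambda>j. t j - zs (q j) (t i)) \<longleftrightarrow> divisible J (map_prod id pull ` U) t"
    for t :: "'j \<Rightarrow> 'a"
    by (simp add: divisible_def case_prod_beta pull)
  then have "solvable J K C t \<longleftrightarrow> divisible J (U0 \<union> map_prod id pull ` U) t" for t :: "'j \<Rightarrow> 'a"
    using eq U(2) by (simp add: divisible_def ball_Un)
  then show ?thesis
    unfolding reducible_def using U0 U(1) by (intro exI[of _ "U0 \<union> map_prod id pull ` U"]) auto
qed

lemma sum_row_combination:
  "(\<Sum>k\<in>K. zs (C j k - m * C i k) (w k)) =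
    (\<Sum>k\<in>K. zs (C j k) (w k)) - zs m (\<Sum>k\<in>K. zs (C i k) (w k))"
  by (simp add: zs.scale_left_diff_distrib sum_subtractf zs.scale_sum_right)

text \<open>Because of \<open>q i = 0\<close> row \<open>i\<close> itself is kept, which makes the
  operation invertible.\<close>

lemma solvable_row_operation:
  assumes "i \<in> J" "q i = 0"
  shows "solvable J K C t \<longleftrightarrow>
    solvable J K (\<lambda>j k. C j k - q j * C i k) (\<lambda>j. t j - zs (q j) (t i))"
proof -
  have "(\<forall>j\<in>J. s j = t j) \<longleftrightarrow> (\<forall>j\<in>J. s j - zs (q j) (s i) = t j - zs (q j) (t i))" for s
  proof
    assume r: "\<forall>j\<in>J. s j - zs (q j) (s i) = t j - zs (q j) (t i)"
    have "s i = t i" using bspec[OF r assms(1)] assms(2) by simp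
    then show "\<forall>j\<in>J. s j = t j" using r by simp
  qed (use assms in simp)
  then have "(\<forall>j\<in>J. (\<Sum>k\<in>K. zs (C j k) (w k)) = t j) \<longleftrightarrow>
    (\<forall>j\<in>J. (\<Sum>k\<in>K. zs (C j k - q j * C i k) (w k)) = t j - zs (q j) (t i))" for w
    unfolding sum_row_combination by simp
  then show ?thesis unfolding solvable_def by simp
qed

text \<open>The change of column \<open>l\<close> is compensated by replacing the unknown
  \<open>w k\<close> with \<open>w k + m * w l\<close>. One direction suffices, as the inverse
  operation has the same form with \<open>- m\<close>.\<close>

lemma solvable_column_operation:
  assumes "finite K" "k \<in> K" "l \<in> K" "k \<noteq> l"
    and "solvable J K C t"
  shows "solvable J K (\<lambda>j x. C j x - (if x = l then m * C j k else 0)) t"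
proof -
  obtain w where w: "\<And>j. j \<in> J \<Longrightarrow> (\<Sum>x\<in>K. zs (C j x) (w x)) = t j"
    using assms(5) unfolding solvable_def by blast
  have "(\<Sum>x\<in>K. zs (C j x - (if x = l then m * C j k else 0)) ((w(k := w k + zs m (w l))) x)) =
    (\<Sum>x\<in>K. zs (C j x) (w x))" for j
  proof -
    have "zs (C j x - (if x = l then m * C j k else 0)) ((w(k := w k + zs m (w l))) x) =
        zs (C j x) (w x) + ((if x = k then zs (m * C j k) (w l) else 0) -
          (if x = l then zs (m * C j k) (w l) else 0))" for x
      using assms(4) by (simp add: zs.scale_left_diff_distrib zs.scale_right_distrib mult.commute)
    then show ?thesis
      using assms(1-3) by (simp add: sum.distrib sum_subtractf)
  qed
  then have "\<forall>j\<in>J. (\<Sum>x\<in>K. zs (C j x - (if x = l then m * C j k else 0))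
      ((w(k := w k + zs m (w l))) x)) = t j"
    using w by simp
  then show ?thesis
    unfolding solvable_def by (intro exI[of _ "w(k := w k + zs m (w l))"])
qed

text \<open>Since the pivot divides its row, row \<open>i\<close> says that the pivot times
  \<open>\<Sum>l. r l * w l\<close> equals \<open>t i\<close>. Clearing column \<open>k\<close>
  turns row \<open>i\<close> into zero as well, because \<open>q i = 1\<close>.\<close>

lemma solvable_pivot:
  assumes K: "finite K" "k \<in> K" and i: "i \<in> J"
    and col: "\<And>j. j \<in> J \<Longrightarrow> C j k = C i k * q j" and row: "\<And>l. l \<in> K \<Longrightarrow> C i l = C i k * r l"
    and "q i = 1" "r k = 1"
  shows "solvable J K C t \<longleftrightarrow> (\<exists>y. zs (C i k) y = t i) \<and>
    solvable J K (\<lambda>j k. C j k - q j * C i k) (\<lambda>j. t j - zs (q j) (t i))"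
proof
  assume "solvable J K C t"
  then obtain w where w: "\<And>j. j \<in> J \<Longrightarrow> (\<Sum>x\<in>K. zs (C j x) (w x)) = t j"
    unfolding solvable_def by blast
  have "zs (C i k) (\<Sum>l\<in>K. zs (r l) (w l)) = (\<Sum>l\<in>K. zs (C i l) (w l))"
    by (simp add: zs.scale_sum_right row)
  then have "zs (C i k) (\<Sum>l\<in>K. zs (r l) (w l)) = t i" using w[OF i] by simp
  moreover have "(\<Sum>x\<in>K. zs (C j x - q j * C i x) (w x)) = t j - zs (q j) (t i)" if "j \<in> J" for j
    unfolding sum_row_combination using w that i by simp
  ultimately show "(\<exists>y. zs (C i k) y = t i) \<and>
      solvable J K (\<lambda>j k. C j k - q j * C i k) (\<lambda>j. t j - zs (q j) (t i))"
    unfolding solvable_def by blast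
next
  assume "(\<exists>y. zs (C i k) y = t i) \<and>
      solvable J K (\<lambda>j k. C j k - q j * C i k) (\<lambda>j. t j - zs (q j) (t i))"
  then obtain y w where y: "zs (C i k) y = t i"
    and w: "\<And>j. j \<in> J \<Longrightarrow> (\<Sum>x\<in>K. zs (C j x - q j * C i x) (w x)) = t j - zs (q j) (t i)"
    unfolding solvable_def by blast
  \<comment> \<open>Column \<open>k\<close> of the reduced system is zero, so the unknown at
    \<open>k\<close> may be reset to satisfy row \<open>i\<close>.\<close>
  define v where "v = w(k := y - (\<Sum>l\<in>K - {k}. zs (r l) (w l)))"
  have "(\<Sum>l\<in>K. zs (r l) (v l)) = y"
    using K \<open>r k = 1\<close> by (simp add: sum.remove[of K k] v_def)
  then have vi: "(\<Sum>l\<in>K. zs (C i l) (v l)) = t i"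
    using y by (simp add: row flip: zs.scale_scale zs.scale_sum_right)
  have "(\<Sum>x\<in>K. zs (C j x) (v x)) = t j" if j: "j \<in> J" for j
  proof -
    have "C j k - q j * C i k = 0" using col[OF j] by simp
    then have "(\<Sum>x\<in>K. zs (C j x - q j * C i x) (v x)) = (\<Sum>x\<in>K. zs (C j x - q j * C i x) (w x))"
      by (intro sum.cong) (auto simp: v_def)
    then show ?thesis using w[OF j] vi unfolding sum_row_combination by simp
  qed
  then show "solvable J K C t" unfolding solvable_def by blast
qed

text \<open>The Smith normal form algorithm, run on the system: a pivot dividing its row and its column
  splits off one divisibility condition and kills a row.\<close>

lemma reducible:
  fixes C :: "'j \<Rightarrow> 'k \<Rightarrow> int"
  assumes J: "finite J" and K: "finite K"
  shows "reducible TYPE('a::ab_group_add) J K C"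
proof -
  define rows where "rows C = {j \<in> J. \<exists>k\<in>K. C j k \<noteq> 0}" for C :: "'j \<Rightarrow> 'k \<Rightarrow> int"
  have fin_rows: "finite (rows C)" for C using J by (simp add: rows_def)
  show ?thesis
  \<comment> \<open>The outer induction is on the number of nonzero rows, the inner one on the
    absolute value of the pivot.\<close>
  proof (induction "card (rows C)" arbitrary: C rule: less_induct)
    case less
    have pivot: "reducible TYPE('a) J K C'"
      if "rows C' \<subseteq> rows C" "i \<in> J" "k \<in> K" "C' i k \<noteq> 0" for C' i k
      using that
    proof (induction "nat \<bar>C' i k\<bar>" arbitrary: C' i k rule: less_induct)
      case (less C' i k)
      note fewer_rows = \<open>\<And>C'. card (rows C') < card (rows C) \<Longrightarrow> reducible TYPE('a) J K C'\<close>
      have smaller: "\<bar>x mod C' i k\<bar> < \<bar>C' i k\<bar>" for x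
        using less.prems(4) by (simp add: abs_mod_less)
      \<comment> \<open>In the first two cases division with remainder produces a smaller nonzero
        pivot in the same column or row; in the third case row \<open>i\<close> is
        eliminated.\<close>
      consider (col) j where "j \<in> J" "\<not> C' i k dvd C' j k"
        | (row) l where "l \<in> K" "\<not> C' i k dvd C' i l"
        | (div) "\<And>j. j \<in> J \<Longrightarrow> C' i k dvd C' j k" "\<And>l. l \<in> K \<Longrightarrow> C' i k dvd C' i l"
        by blast
      then show ?case
      proof cases
        case col
        define q where "q = (\<lambda>x. if x = j then C' j k div C' i k else 0)"
        define C'' where "C'' = (\<lambda>j k. C' j k - q j * C' i k)"
        have ji: "j \<noteq> i" using col(2) by auto
        have C''jk: "C'' j k = C' j k mod C' i k"
          by (simp add: C''_def q_def minus_div_mult_eq_mod)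
        have "rows C'' \<subseteq> rows C'"
          using col ji less.prems(3) by (auto simp: rows_def C''_def q_def split: if_splits)
            (metis dvd_0_right)
        then have "reducible TYPE('a) J K C''"
          using col less.prems smaller[of "C' j k"]
          by (intro less.hyps[of C'' j k]) (auto simp: C''jk dvd_eq_mod_eq_0)
        then show ?thesis
          using J less.prems(2) solvable_row_operation[of i J q K C'] ji
          by (intro reducible_pullback[of J i "{}" K C'' C' q])
            (auto simp: C''_def q_def divisible_def)
      next
        case row
        define m where "m = C' i l div C' i k"
        define C'' where "C'' = (\<lambda>j x. C' j x - (if x = l then m * C' j k else 0))"
        have kl: "k \<noteq> l" using row(2) by auto
        have C''il: "C'' i l = C' i l mod C' i k"
          by (simp add: C''_def m_def minus_div_mult_eq_mod)
        have "rows C'' \<subseteq> rows C'"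
          using row kl less.prems(3) by (auto simp: rows_def C''_def split: if_splits)
            (metis mult_zero_right)
        then have red: "reducible TYPE('a) J K C''"
          using row less.prems smaller[of "C' i l"]
          by (intro less.hyps[of C'' i l]) (auto simp: C''il dvd_eq_mod_eq_0)
        have inv: "C' = (\<lambda>j x. C'' j x - (if x = l then (- m) * C'' j k else 0))"
          using kl by (auto simp: C''_def fun_eq_iff)
        have "solvable J K C' t \<longleftrightarrow> solvable J K C'' t" for t :: "'j \<Rightarrow> 'a"
        proof
          assume "solvable J K C' t"
          from solvable_column_operation[OF K less.prems(3) row(1) kl this, of m]
          show "solvable J K C'' t" unfolding C''_def .
        next
          assume "solvable J K C'' t"
          from solvable_column_operation[OF K less.prems(3) row(1) kl this, of "- m"]
          show "solvable J K C' t" by (subst inv)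
        qed
        then show ?thesis using red unfolding reducible_def by simp
      next
        case div
        define q where "q = (\<lambda>j. C' j k div C' i k)"
        define C'' where "C'' = (\<lambda>j k. C' j k - q j * C' i k)"
        have "rows C'' \<subseteq> rows C' - {i}"
        proof
          fix j assume "j \<in> rows C''"
          then obtain l where l: "j \<in> J" "l \<in> K" "C'' j l \<noteq> 0" by (auto simp: rows_def)
          then have "j \<noteq> i" using less.prems(4) by (auto simp: C''_def q_def)
          moreover have "C' j l \<noteq> 0 \<or> C' j k \<noteq> 0" using l(3) by (auto simp: C''_def q_def)
          ultimately show "j \<in> rows C' - {i}" using l less.prems(3) by (auto simp: rows_def)
        qed
        moreover have "i \<in> rows C'" using less.prems by (auto simp: rows_def)
        ultimately have "rows C'' \<subset> rows C" using less.prems(1) by blast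
        then have "reducible TYPE('a) J K C''"
          by (intro fewer_rows psubset_card_mono fin_rows)
        moreover have "divisible J {(C' i k, \<lambda>j. if j = i then 1 else 0)} t \<longleftrightarrow>
            (\<exists>y. zs (C' i k) y = t i)" for t :: "'j \<Rightarrow> 'a"
          using J less.prems(2)
          by (simp add: divisible_def if_distrib[of "\<lambda>n. zs n _"] cong: if_cong)
        moreover have "solvable J K C' t \<longleftrightarrow> (\<exists>y. zs (C' i k) y = t i) \<and>
            solvable J K C'' (\<lambda>j. t j - zs (q j) (t i))" for t :: "'j \<Rightarrow> 'a"
          unfolding C''_def using less.prems(4) div
          by (intro solvable_pivot[where r = "\<lambda>l. C' i l div C' i k"] K less.prems(2,3))
            (auto simp: q_def)
        ultimately show ?thesis
          using J less.prems(2)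
          by (intro reducible_pullback[of J i "{(C' i k, \<lambda>j. if j = i then 1 else 0)}" K C'' C' q])
            auto
      qed
    qed
    show ?case
    proof (cases "rows C = {}")
      case True
      then have "solvable J K C t \<longleftrightarrow> (\<forall>j\<in>J. t j = 0)" for t :: "'j \<Rightarrow> 'a"
        by (auto simp: solvable_def rows_def)
      moreover have "divisible J ((\<lambda>i. (0, \<lambda>j. if j = i then 1 else 0)) ` J) t \<longleftrightarrow> (\<forall>j\<in>J. t j = 0)"
        for t :: "'j \<Rightarrow> 'a"
        using J by (simp add: divisible_def if_distrib[of "\<lambda>n. zs n _"] cong: if_cong)
      ultimately show ?thesis
        unfolding reducible_def using J
        by (intro exI[of _ "(\<lambda>i. (0, \<lambda>j. if j = i then 1 else 0)) ` J"]) auto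
    next
      case False
      then obtain i k where "i \<in> J" "k \<in> K" "C i k \<noteq> 0" by (auto simp: rows_def)
      then show ?thesis by (rule pivot[OF order_refl])
    qed
  qed
qed

subsection \<open>Subgroups defined by divisibility conditions\<close>

text \<open>Valuations have infinitely many coordinates; the inductive definition ensures that only
  finitely many of them occur.\<close>

inductive linear_form :: "((nat \<Rightarrow> 'a::ab_group_add) \<Rightarrow> 'a) \<Rightarrow> bool" where
  zero: "linear_form (\<lambda>e. 0)"
| add: "linear_form f \<Longrightarrow> linear_form (\<lambda>e. f e + zs c (e i))"

lemma linear_form_plus:
  assumes "linear_form f" "linear_form g"
  shows "linear_form (\<lambda>e. f e + g e)"
  using assms(2)
proof induction
  case (add g c i)
  then show ?case using linear_form.add[of "\<lambda>e. f e + g e" c i] by (simp add: add.assoc)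
qed (simp add: assms(1))

lemma linear_form_zs:
  assumes "linear_form f"
  shows "linear_form (\<lambda>e. zs c (f e))"
  using assms
proof induction
  case (add f c' i)
  then show ?case
    using linear_form.add[of "\<lambda>e. zs c (f e)" "c * c'" i] by (simp add: zs.scale_right_distrib)
qed (simp add: linear_form.zero)

lemma linear_form_diff:
  assumes "linear_form f" "linear_form g"
  shows "linear_form (\<lambda>e. f e - g e)"
  using linear_form_plus[OF assms(1) linear_form_zs[OF assms(2), of "- 1"]]
  by (simp add: zs.scale_minus_left)

lemma linear_form_var: "linear_form (\<lambda>e. e i)"
  using linear_form.add[OF linear_form.zero, of 1 i] by simp

lemma linear_form_sum:
  "(\<And>j. j \<in> J \<Longrightarrow> linear_form (f j)) \<Longrightarrow> linear_form (\<lambda>e. \<Sum>j\<in>J. f j e)"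
  by (induction J rule: infinite_finite_induct) (simp_all add: linear_form.zero linear_form_plus)

lemma linear_form_trm_val: "linear_form (\<lambda>e. trm_val e s)"
  by (induction s) (simp_all add: linear_form.zero linear_form_plus linear_form_var)

lemma linear_form_eval_diff: "linear_form f \<Longrightarrow> f (e - e') = f e - f e'"
  by (induction rule: linear_form.induct) (simp_all add: zs.scale_right_diff_distrib)

lemma linear_form_eval_0: "linear_form f \<Longrightarrow> f 0 = 0"
  using linear_form_eval_diff[of f 0 0] by simp

lemma linear_form_split:
  assumes "linear_form f"
  shows "\<exists>c g. linear_form g \<and> (\<forall>e a. f (e(i := a)) = g e + zs c a)"
  using assms
proof induction
  case zero
  then show ?case by (intro exI[of _ 0] exI[of _ "\<lambda>e. 0"]) (simp add: linear_form.zero)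
next
  case (add f c j)
  then obtain c' g where g: "linear_form g" "\<And>e a. f (e(i := a)) = g e + zs c' a" by blast
  show ?case
  proof (cases "j = i")
    case True
    have "f (e(i := a)) + zs c ((e(i := a)) j) = g e + zs (c' + c) a" for e a
      using g(2)[of e a] True by (simp add: zs.scale_left_distrib add.assoc)
    then show ?thesis using g(1) by blast
  next
    case False
    have "f (e(i := a)) + zs c ((e(i := a)) j) = (g e + zs c (e j)) + zs c' a" for e a
      using g(2)[of e a] False by (simp add: ac_simps)
    then show ?thesis using linear_form.add[OF g(1), of c j] by blast
  qed
qed

definition pp_set :: "(int \<times> ((nat \<Rightarrow> 'a::ab_group_add) \<Rightarrow> 'a)) set \<Rightarrow> (nat \<Rightarrow> 'a) set" where
  "pp_set W = {e. \<forall>(d, f)\<in>W. \<exists>z. zs d z = f e}"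

text \<open>These are the subgroups definable by positive primitive formulas: \<open>pp_Ex\<close>
  shows that existential quantifiers add nothing new.\<close>

definition pp :: "(nat \<Rightarrow> 'a::ab_group_add) set \<Rightarrow> bool" where
  "pp H \<longleftrightarrow> (\<exists>W. finite W \<and> (\<forall>(d, f)\<in>W. linear_form f) \<and> H = pp_set W)"

lemma ppI: "finite W \<Longrightarrow> (\<And>d f. (d, f) \<in> W \<Longrightarrow> linear_form f) \<Longrightarrow> pp (pp_set W)"
  unfolding pp_def by blast

lemma pp_UNIV: "pp UNIV"
  using ppI[of "{}"] by (simp add: pp_set_def)

lemma pp_Int:
  assumes "pp H" "pp K"
  shows "pp (H \<inter> K)"
proof -
  obtain V W where "finite V" "\<forall>(d, f)\<in>V. linear_form f" "H = pp_set V"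
    "finite W" "\<forall>(d, f)\<in>W. linear_form f" "K = pp_set W"
    using assms unfolding pp_def by blast
  moreover have "pp_set V \<inter> pp_set W = pp_set (V \<union> W)"
    by (simp add: pp_set_def ball_Un Collect_conj_eq)
  ultimately show ?thesis using ppI[of "V \<union> W"] by auto
qed

lemma pp_INT:
  "finite I \<Longrightarrow> (\<And>i. i \<in> I \<Longrightarrow> pp (H i)) \<Longrightarrow> pp (\<Inter>i\<in>I. H i)"
  by (induction I rule: finite_induct) (simp_all add: pp_UNIV pp_Int)

lemma pp_subgrp:
  assumes "pp H"
  shows "subgrp H"
proof -
  obtain W where W: "\<And>d f. (d, f) \<in> W \<Longrightarrow> linear_form f" "H = pp_set W"
    using assms unfolding pp_def by blast
  have "\<exists>z. zs d z = f (e - e')"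
    if "(d, f) \<in> W" "zs d x = f e" "zs d y = f e'" for d f e e' x y
    using that linear_form_eval_diff[OF W(1)[OF that(1)], of e e']
    by (intro exI[of _ "x - y"]) (simp add: zs.scale_right_diff_distrib)
  moreover have "\<exists>z. zs d z = f 0" if "(d, f) \<in> W" for d f
    using linear_form_eval_0[OF W(1)[OF that]] by (intro exI[of _ 0]) simp
  ultimately show ?thesis
    unfolding W(2) subgrp_def pp_set_def by fast
qed

text \<open>The quantified element and the quotients in the divisibility conditions are the unknowns
  of a linear system whose right-hand sides are linear forms in \<open>e\<close>. By
  \<open>reducible\<close> its solvability amounts to divisibility conditions on those
  forms.\<close>

lemma pp_Ex:
  assumes "pp H"
  shows "pp {e. \<exists>a. e(i := a) \<in> H}"
proof -
  obtain W :: "(int \<times> ((nat \<Rightarrow> 'a) \<Rightarrow> 'a)) set" where W: "finite W" "\<And>d f. (d, f) \<in> W \<Longrightarrow> linear_form f" "H = pp_set W"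
    using assms unfolding pp_def by blast
  have "\<forall>w\<in>W. \<exists>c g. linear_form g \<and> (\<forall>e a. snd w (e(i := a)) = g e + zs c a)"
    using W(2) linear_form_split by fastforce
  then obtain c g where g: "\<And>w. w \<in> W \<Longrightarrow> linear_form (g w)"
    "\<And>w e a. w \<in> W \<Longrightarrow> snd w (e(i := a)) = g w e + zs (c w) a"
    by metis
  \<comment> \<open>\<open>None\<close> indexes the quantified element, \<open>Some w\<close> the
    quotient in the condition \<open>w\<close>.\<close>
  define K where "K = insert None (Some ` W)"
  define C where "C w k = (case k of None \<Rightarrow> - c w | Some w' \<Rightarrow> if w = w' then fst w else 0)" for w k
  have row: "(\<Sum>k\<in>K. zs (C w k) (v k)) = zs (fst w) (v (Some w)) - zs (c w) (v None)"
    if "w \<in> W" for w and v :: "_ \<Rightarrow> 'a"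
  proof -
    have "(\<Sum>k\<in>Some ` W. zs (C w k) (v k)) = (\<Sum>w'\<in>W. if w = w' then zs (fst w) (v (Some w)) else 0)"
      by (subst sum.reindex) (auto simp: C_def intro!: sum.cong)
    then show ?thesis using W(1) that by (simp add: K_def C_def zs.scale_minus_left)
  qed
  have "(\<exists>a. e(i := a) \<in> H) \<longleftrightarrow> solvable W K C (\<lambda>w. g w e)" for e
  proof
    assume "\<exists>a. e(i := a) \<in> H"
    then obtain a where "\<And>w. w \<in> W \<Longrightarrow> \<exists>z. zs (fst w) z = g w e + zs (c w) a"
      unfolding W(3) pp_set_def using g(2) by fastforce
    then obtain z where "\<And>w. w \<in> W \<Longrightarrow> zs (fst w) (z w) = g w e + zs (c w) a" by metis
    then have "\<forall>w\<in>W. (\<Sum>k\<in>K. zs (C w k) (case_option a z k)) = g w e"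
      by (simp add: row)
    then show "solvable W K C (\<lambda>w. g w e)" unfolding solvable_def by blast
  next
    assume "solvable W K C (\<lambda>w. g w e)"
    then obtain v where v: "\<And>w. w \<in> W \<Longrightarrow> (\<Sum>k\<in>K. zs (C w k) (v k)) = g w e"
      unfolding solvable_def by blast
    have "zs (fst w) (v (Some w)) = snd w (e(i := v None))" if "w \<in> W" for w
      using v[OF that] row[OF that, of v] g(2)[OF that] by (simp add: algebra_simps)
    then have "e(i := v None) \<in> H" unfolding W(3) pp_set_def by force
    then show "\<exists>a. e(i := a) \<in> H" by blast
  qed
  moreover obtain U where U: "finite U"
    "\<And>t :: _ \<Rightarrow> 'a. solvable W K C t \<longleftrightarrow> divisible W U t"
    using reducible[of W K C, where 'a = 'a] W(1) unfolding reducible_def K_def by auto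
  moreover have "divisible W U (\<lambda>w. g w e) \<longleftrightarrow>
      e \<in> pp_set ((\<lambda>(d, u). (d, \<lambda>e. \<Sum>w\<in>W. zs (u w) (g w e))) ` U)" for e
    by (auto simp: divisible_def pp_set_def)
  ultimately have "{e. \<exists>a. e(i := a) \<in> H} =
      pp_set ((\<lambda>(d, u). (d, \<lambda>e. \<Sum>w\<in>W. zs (u w) (g w e))) ` U)" by auto
  moreover have "pp \<dots>"
    using U(1) g(1) by (intro ppI) (auto intro!: linear_form_sum linear_form_zs)
  ultimately show ?thesis by simp
qed


subsection \<open>Quantifier elimination\<close>

text \<open>A semantic way to say that \<open>X\<close> is a Boolean combination of finitely many pp
  subgroups.\<close>

definition pp_determined :: "(nat \<Rightarrow> 'a::ab_group_add) set \<Rightarrow> bool" where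
  "pp_determined X \<longleftrightarrow> (\<exists>F. finite F \<and> (\<forall>H\<in>F. pp H) \<and>
     (\<forall>e e'. (\<forall>H\<in>F. e \<in> H \<longleftrightarrow> e' \<in> H) \<longrightarrow> (e \<in> X \<longleftrightarrow> e' \<in> X)))"

text \<open>The subgroup on the left does not depend on \<open>e\<close>. Fibres over different
  points can therefore be compared by \<open>coset_cover_transfer\<close>.\<close>

lemma coset_of_fibre:
  assumes "subgrp H"
  shows "coset_of {b. (0 :: nat \<Rightarrow> 'a::ab_group_add)(i := b) \<in> H} {b. e(i := b) \<in> H}"
proof -
  have "e(i := y) \<in> H \<longleftrightarrow> 0(i := y - x) \<in> H" if "e(i := x) \<in> H" for x y
  proof -
    have "e(i := y) = 0(i := y - x) + e(i := x)" by auto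
    then show ?thesis using subgrp_add_cancel[OF assms that] by simp
  qed
  then show ?thesis unfolding coset_of_def by auto
qed

lemma subgrp_fibre:
  assumes "subgrp H"
  shows "subgrp {b. (0 :: nat \<Rightarrow> 'a::ab_group_add)(i := b) \<in> H}"
proof -
  have "0(i := x - y) = 0(i := x) - (0 :: nat \<Rightarrow> 'a)(i := y)" for x y by auto
  moreover have "0(i := 0) = (0 :: nat \<Rightarrow> 'a)" by auto
  ultimately show ?thesis using assms unfolding subgrp_def by simp
qed

text \<open>A pattern \<open>G\<close> is realised over \<open>e\<close> iff the fibre of
  \<open>\<Inter> G\<close> is not covered by the fibres of the other members of \<open>F\<close>.
  By \<open>coset_cover_transfer\<close> this depends only on which intersections of fibres are
  nonempty, and these conditions on \<open>e\<close> are pp by \<open>pp_Ex\<close>.\<close>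

lemma pp_determined_Ex:
  assumes "pp_determined X"
  shows "pp_determined {e :: nat \<Rightarrow> 'a::ab_group_add. \<exists>a. e(i := a) \<in> X}"
proof -
  obtain F where F: "finite F" "\<And>H. H \<in> F \<Longrightarrow> pp H"
    "\<And>e e'. (\<And>H. H \<in> F \<Longrightarrow> e \<in> H \<longleftrightarrow> e' \<in> H) \<Longrightarrow> e \<in> X \<longleftrightarrow> e' \<in> X"
    using assms unfolding pp_determined_def by metis
  define E where "E G = {e. \<exists>a. e(i := a) \<in> \<Inter> G}" for G :: "(nat \<Rightarrow> 'a) set set"
  have pp: "pp (\<Inter> G)" if "G \<subseteq> F" for G
    using that F(1,2) pp_INT[of G id] by (auto simp: finite_subset)
  have step: "\<exists>a. e' (i := a) \<in> X"
    if agree: "\<And>G. G \<subseteq> F \<Longrightarrow> e \<in> E G \<longleftrightarrow> e' \<in> E G" and a: "e(i := a) \<in> X" for e e' a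
  proof -
    define G where "G = {H \<in> F. e(i := a) \<in> H}"
    have G: "G \<subseteq> F" by (auto simp: G_def)
    have "\<not> {b. e'(i := b) \<in> \<Inter> G} \<subseteq> (\<Union>H\<in>F - G. {b. e'(i := b) \<in> H})"
    proof
      assume cover: "{b. e'(i := b) \<in> \<Inter> G} \<subseteq> (\<Union>H\<in>F - G. {b. e'(i := b) \<in> H})"
      have "{b. e(i := b) \<in> \<Inter> G} \<subseteq> (\<Union>H\<in>F - G. {b. e(i := b) \<in> H})"
      proof (rule coset_cover_transfer[where ?K0.0 = "{b. 0(i := b) \<in> \<Inter> G}"
            and K = "\<lambda>H. {b. 0(i := b) \<in> H}"])
        have mem_E: "{b. e(i := b) \<in> \<Inter> G} \<inter> (\<Inter>H\<in>J. {b. e(i := b) \<in> H}) \<noteq> {} \<longleftrightarrow> e \<in> E (G \<union> J)"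
          for e J by (auto simp: E_def ball_Un)
        fix J assume "J \<subseteq> F - G"
        then show "{b. e'(i := b) \<in> \<Inter> G} \<inter> (\<Inter>H\<in>J. {b. e'(i := b) \<in> H}) \<noteq> {} \<longleftrightarrow>
          {b. e(i := b) \<in> \<Inter> G} \<inter> (\<Inter>H\<in>J. {b. e(i := b) \<in> H}) \<noteq> {}"
          using agree[of "G \<union> J"] G unfolding mem_E by blast
      qed (use F(1,2) pp[OF G] cover in
          \<open>auto intro!: subgrp_fibre coset_of_fibre pp_subgrp simp del: Inter_iff\<close>)
      then show False by (auto simp: G_def)
    qed
    then obtain b where b: "e'(i := b) \<in> \<Inter> G" "\<And>H. H \<in> F - G \<Longrightarrow> e'(i := b) \<notin> H" by blast
    have "e(i := a) \<in> X \<longleftrightarrow> e'(i := b) \<in> X"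
    proof (rule F(3))
      fix H assume "H \<in> F"
      then show "e(i := a) \<in> H \<longleftrightarrow> e'(i := b) \<in> H" using b by (cases "H \<in> G") (auto simp: G_def)
    qed
    then show ?thesis using a by blast
  qed
  show ?thesis
    unfolding pp_determined_def
  proof (intro exI[of _ "E ` Pow F"] conjI allI impI)
    show "\<forall>H\<in>E ` Pow F. pp H" using pp unfolding E_def by (auto intro!: pp_Ex simp del: Inter_iff)
    fix e e' assume "\<forall>H\<in>E ` Pow F. e \<in> H \<longleftrightarrow> e' \<in> H"
    then show "e \<in> {e. \<exists>a. e(i := a) \<in> X} \<longleftrightarrow> e' \<in> {e. \<exists>a. e(i := a) \<in> X}"
      using step[of e e'] step[of e' e] by auto
  qed (use F(1) in simp)
qed

lemma pp_determined_sat: "pp_determined {e :: nat \<Rightarrow> 'a::ab_group_add. sat e \<phi>}"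
proof (induction \<phi>)
  case (Eq s t)
  let ?H = "pp_set {(0, \<lambda>e :: nat \<Rightarrow> 'a. trm_val e s - trm_val e t)}"
  have "pp ?H" by (intro ppI) (auto intro!: linear_form_diff linear_form_trm_val)
  moreover have "{e. sat e (Eq s t)} = ?H" by (auto simp: pp_set_def)
  ultimately show ?case unfolding pp_determined_def by (intro exI[of _ "{?H}"]) simp
next
  case (Neg \<phi>)
  then show ?case by (simp add: pp_determined_def)
next
  case (Conj \<phi> \<psi>)
  from Conj.IH show ?case
    unfolding pp_determined_def
  proof (elim exE conjE)
    fix F G :: "(nat \<Rightarrow> 'a) set set"
    assume F: "finite F" "\<forall>H\<in>F. pp H" "\<forall>e e'. (\<forall>H\<in>F. e \<in> H \<longleftrightarrow> e' \<in> H) \<longrightarrow>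
        (e \<in> {e. sat e \<phi>} \<longleftrightarrow> e' \<in> {e. sat e \<phi>})"
      and G: "finite G" "\<forall>H\<in>G. pp H" "\<forall>e e'. (\<forall>H\<in>G. e \<in> H \<longleftrightarrow> e' \<in> H) \<longrightarrow>
        (e \<in> {e. sat e \<psi>} \<longleftrightarrow> e' \<in> {e. sat e \<psi>})"
    have "sat e \<phi> \<and> sat e \<psi> \<longleftrightarrow> sat e' \<phi> \<and> sat e' \<psi>"
      if "\<forall>H\<in>F \<union> G. e \<in> H \<longleftrightarrow> e' \<in> H" for e e' :: "nat \<Rightarrow> 'a"
      using F(3)[rule_format, of e e'] G(3)[rule_format, of e e'] that by auto
    then show "\<exists>F. finite F \<and> (\<forall>H\<in>F. pp H) \<and> (\<forall>e e' :: nat \<Rightarrow> 'a. (\<forall>H\<in>F. e \<in> H \<longleftrightarrow> e' \<in> H) \<longrightarrow>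
        (e \<in> {e. sat e (Conj \<phi> \<psi>)} \<longleftrightarrow> e' \<in> {e. sat e (Conj \<phi> \<psi>)}))"
      using F G by (intro exI[of _ "F \<union> G"]) auto
  qed
next
  case (Ex i \<phi>)
  then show ?case using pp_determined_Ex[of "{e. sat e \<phi>}" i] by simp
qed

subsection \<open>Irredundant families\<close>

text \<open>A copy of the power of \<open>A\<close> with index set \<open>V\<close>, so that all
  arities live in one type.\<close>

definition supp :: "nat set \<Rightarrow> (nat \<Rightarrow> 'a::ab_group_add) set" where
  "supp V = {e. \<forall>i. i \<notin> V \<longrightarrow> e i = 0}"

lemma subgrp_supp: "subgrp (supp V)"
  by (auto simp: subgrp_def supp_def)

definition irredundant :: "'g::ab_group_add set \<Rightarrow> 'i set \<Rightarrow> ('i \<Rightarrow> 'g set) \<Rightarrow> bool" where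
  "irredundant G I H \<longleftrightarrow>
     (\<forall>i\<in>I. \<not> G \<inter> (\<Inter>j\<in>I - {i}. H j) \<lesssim> G \<inter> (\<Inter>j\<in>I. H j))"

text \<open>A subfamily of least cardinality with the same intersection up to finite index is
  irredundant.\<close>

lemma irredundant_subfamily:
  assumes "finite I"
  obtains J where "J \<subseteq> I" "G \<inter> (\<Inter>j\<in>J. H j) \<lesssim> G \<inter> (\<Inter>j\<in>I. H j)" "irredundant G J H"
proof -
  let ?P = "\<lambda>J. J \<subseteq> I \<and> G \<inter> (\<Inter>j\<in>J. H j) \<lesssim> G \<inter> (\<Inter>j\<in>I. H j)"
  have "?P I" by (simp add: almost_subset)
  then have "\<exists>J. ?P J \<and> (\<forall>J'. ?P J' \<longrightarrow> card J \<le> card J')"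
    by (rule ex_has_least_nat)
  then obtain J where min: "?P J \<and> (\<forall>J'. ?P J' \<longrightarrow> card J \<le> card J')" ..
  then have J: "J \<subseteq> I" "G \<inter> (\<Inter>j\<in>J. H j) \<lesssim> G \<inter> (\<Inter>j\<in>I. H j)" by simp_all
  have "irredundant G J H"
    unfolding irredundant_def
  proof (intro ballI notI)
    fix i assume i: "i \<in> J" "G \<inter> (\<Inter>j\<in>J - {i}. H j) \<lesssim> G \<inter> (\<Inter>j\<in>J. H j)"
    then have "?P (J - {i})" using J(1) almost_trans[OF i(2) J(2)] by auto
    then have "card J \<le> card (J - {i})" using min by blast
    moreover have "card (J - {i}) < card J"
      using i(1) J(1) assms by (meson card_Diff1_less finite_subset)
    ultimately show False by simp
  qed
  then show ?thesis using that[OF J] by simp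
qed

text \<open>The rank argument: a subfamily \<open>J\<close> that is maximal such that the intersection over its
  complement meets the fibre \<open>supp {v}\<close> almost trivially stays irredundant after projection, and
  the complement of \<open>J\<close> stays irredundant in the fibre.\<close>

lemma irredundant_card:
  fixes I :: "'i set" and H :: "'i \<Rightarrow> (nat \<Rightarrow> 'a::ab_group_add) set"
  assumes base: "\<And>v I (H :: 'i \<Rightarrow> (nat \<Rightarrow> 'a) set). finite I \<Longrightarrow> \<forall>j\<in>I. pp (H j) \<Longrightarrow>
      irredundant (supp {v}) I H \<Longrightarrow> card I \<le> d"
    and "finite V" "finite I" "\<forall>j\<in>I. pp (H j)" "irredundant (supp V) I H"
  shows "card I \<le> d * card V"
  using assms(2-)
proof (induction V arbitrary: I H)
  case empty
  \<comment> \<open>The trivial group has no subgroup of infinite index, so no member of a family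
    can be essential there.\<close>
  have "I = {}"
  proof (rule ccontr)
    assume "I \<noteq> {}"
    then obtain i where i: "i \<in> I" by blast
    have "supp {} = {0 :: nat \<Rightarrow> 'a}" by (auto simp: supp_def)
    moreover have "0 \<in> supp {} \<inter> (\<Inter>j\<in>I. H j)"
      using empty.prems pp_subgrp subgrp_0 by (auto simp: supp_def)
    ultimately have "supp {} \<inter> (\<Inter>j\<in>I - {i}. H j) \<lesssim> supp {} \<inter> (\<Inter>j\<in>I. H j)"
      by (intro almost_finite) auto
    then show False using empty.prems(3) i by (auto simp: irredundant_def)
  qed
  then show ?case by simp
next
  case (insert v V)
  \<comment> \<open>The intersection with the members of \<open>J\<close> left out:
    \<open>Y {}\<close> is the full intersection, and larger \<open>J\<close> give larger
    groups.\<close>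
  define Y where "Y J = supp (insert v V) \<inter> (\<Inter>j\<in>I - J. H j)" for J
  have subH: "subgrp (H j)" if "j \<in> I" for j
    using insert.prems(2) that pp_subgrp by blast
  have subY: "subgrp (Y J)" for J
    unfolding Y_def using subH by (auto intro!: subgrp_Int subgrp_INT subgrp_supp)
  have Y_mono: "J \<subseteq> J' \<Longrightarrow> Y J \<subseteq> Y J'" for J J'
    by (auto simp: Y_def)
  have irr: "\<not> Y {i} \<lesssim> Y {}" if "i \<in> I" for i
    using insert.prems(3) that by (simp add: irredundant_def Y_def)
  let ?P = "\<lambda>J. J \<subseteq> I \<and> supp {v} \<inter> Y J \<lesssim> Y {}"
  have "?P {}" by (simp add: almost_subset)
  moreover have "\<forall>J. ?P J \<longrightarrow> card J < Suc (card I)"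
    using insert.prems(1) by (simp add: card_mono less_Suc_eq_le)
  ultimately have "\<exists>J. ?P J \<and> (\<forall>J'. ?P J' \<longrightarrow> card J' \<le> card J)"
    by (rule ex_has_greatest_nat)
  then obtain J where max: "?P J \<and> (\<forall>J'. ?P J' \<longrightarrow> card J' \<le> card J)" ..
  then have J: "J \<subseteq> I" "supp {v} \<inter> Y J \<lesssim> Y {}" by simp_all
  have finJ: "finite J" using J(1) insert.prems(1) finite_subset by blast
  have "card (I - J) \<le> d"
  proof (rule base)
    show "irredundant (supp {v}) (I - J) H"
      unfolding irredundant_def
    proof (intro ballI notI)
      fix k assume k: "k \<in> I - J"
        and le: "supp {v} \<inter> (\<Inter>j\<in>I - J - {k}. H j) \<lesssim> supp {v} \<inter> (\<Inter>j\<in>I - J. H j)"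
      have sub: "supp {v} \<subseteq> supp (insert v V)" by (auto simp: supp_def)
      then have "supp {v} \<inter> (\<Inter>j\<in>I - J. H j) \<subseteq> supp {v} \<inter> Y J" by (auto simp: Y_def)
      then have "supp {v} \<inter> (\<Inter>j\<in>I - J. H j) \<lesssim> Y {}" by (rule almost_mono[OF J(2) _ order_refl])
      then have "supp {v} \<inter> Y (insert k J) \<lesssim> Y {}"
        by (rule almost_mono[OF almost_trans[OF le] _ order_refl]) (auto simp: Y_def)
      then have "card (insert k J) \<le> card J" using max k J(1) by simp
      then show False using k finJ by simp
    qed
  qed (use insert.prems in auto)
  moreover have "card J \<le> d * card V"
  proof (rule insert.IH)
    \<comment> \<open>The projection along coordinate \<open>v\<close> of the intersection over
      \<open>k\<close> and the complement of \<open>J\<close>.\<close>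
    define Z where "Z k = {e. \<exists>a. e(v := a) \<in> (\<Inter>j\<in>I - (J - {k}). H j)}" for k
    show pp_Z: "\<forall>k\<in>J. pp (Z k)"
      using insert.prems(1,2) unfolding Z_def by (intro ballI pp_Ex pp_INT) auto
    show "irredundant (supp V) J Z"
      unfolding irredundant_def
    proof (intro ballI notI)
      fix l assume l: "l \<in> J"
        and le: "supp V \<inter> (\<Inter>k\<in>J - {l}. Z k) \<lesssim> supp V \<inter> (\<Inter>k\<in>J. Z k)"
      obtain F where F: "finite F"
        "\<forall>x\<in>supp V \<inter> (\<Inter>k\<in>J - {l}. Z k). \<exists>f\<in>F. x - f \<in> supp V \<inter> (\<Inter>k\<in>J. Z k)"
        using le unfolding almost_in_def by auto
      \<comment> \<open>The preimage of \<open>Z k\<close> under the projection that sets coordinate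
        \<open>v\<close> to zero.\<close>
      define Z' where "Z' k = {y. y(v := 0) \<in> supp V \<inter> Z k}" for k
      have Y_l: "Y {l} \<lesssim> Z' k" if k: "k \<in> J" for k
      proof (rule almost_inI[OF F(1)])
        fix y assume y: "y \<in> Y {l}"
        have y0: "y(v := 0) \<in> supp V \<inter> (\<Inter>k\<in>J - {l}. Z k)"
        proof -
          have "y(v := 0) \<in> Z k" if "k \<in> J - {l}" for k
            unfolding Z_def using y l that by (auto simp: Y_def intro!: exI[of _ "y v"])
          then show ?thesis using y by (auto simp: Y_def supp_def)
        qed
        then obtain f where f: "f \<in> F" "y(v := 0) - f \<in> supp V \<inter> (\<Inter>k\<in>J. Z k)"
          using bspec[OF F(2) y0] by auto
        have "f v = 0" using f(2) insert.hyps(2) by (auto simp: supp_def)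
        then have "(y - f)(v := 0) = y(v := 0) - f" by (auto simp: fun_eq_iff)
        then have "y - f \<in> Z' k" unfolding Z'_def using f(2) k by auto
        then show "\<exists>f\<in>F. y - f \<in> Z' k" using f(1) by (intro bexI[of _ f])
      qed
      have "Y {l} \<lesssim> Y (J - {k})" if k: "k \<in> J" for k
      proof -
        have "Y {l} \<lesssim> Z' k \<inter> Y J"
        proof (rule almost_Int[OF Y_l[OF k] almost_subset _ subY])
          show "Y {l} \<subseteq> Y J" using l by (intro Y_mono) auto
          have "subgrp (supp V \<inter> Z k)" using pp_Z k by (intro subgrp_Int subgrp_supp pp_subgrp) blast
          moreover have "0(v := 0) = (0 :: nat \<Rightarrow> 'a)" by auto
          moreover have "(x - y)(v := 0) = x(v := 0) - y(v := 0)" for x y :: "nat \<Rightarrow> 'a"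
            by (auto simp: fun_eq_iff)
          ultimately show "subgrp (Z' k)" unfolding subgrp_def Z'_def by simp
        qed
        \<comment> \<open>An element \<open>y\<close> on the left shares its projection with some
          \<open>u\<close> in \<open>Y (J - {k})\<close>. The difference \<open>y - u\<close> lies
          in \<open>supp {v} \<inter> Y J\<close>, which is almost contained in \<open>Y {}\<close>
          by the choice of \<open>J\<close>.\<close>
        moreover have "Z' k \<inter> Y J \<lesssim> Y (J - {k})"
        proof -
          obtain F where F: "finite F" "\<forall>x\<in>supp {v} \<inter> Y J. \<exists>f\<in>F. x - f \<in> Y {}"
            using J(2) unfolding almost_in_def by auto
          show ?thesis
          proof (rule almost_inI[OF F(1)])
            fix y assume y: "y \<in> Z' k \<inter> Y J"
            then obtain a where a: "(y(v := 0))(v := a) \<in> (\<Inter>j\<in>I - (J - {k}). H j)"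
              by (auto simp: Z'_def Z_def)
            let ?u = "(y(v := 0))(v := a)"
            have u: "?u \<in> Y (J - {k})" using a y by (auto simp: Y_def supp_def)
            have "?u \<in> Y J" using u Y_mono[of "J - {k}" J] by auto
            then have "y - ?u \<in> Y J" using y subgrp_diff[OF subY] by blast
            moreover have "y - ?u \<in> supp {v}" by (auto simp: supp_def)
            ultimately obtain f where f: "f \<in> F" "y - ?u - f \<in> Y {}"
              using F(2) by (auto dest: bspec[of _ _ "y - ?u"])
            have "y - ?u - f \<in> Y (J - {k})" using f(2) Y_mono[of "{}" "J - {k}"] by auto
            then have "(y - ?u - f) + ?u \<in> Y (J - {k})" using u by (rule subgrp_add[OF subY])
            then have "y - f \<in> Y (J - {k})" by (simp add: algebra_simps)
            then show "\<exists>f\<in>F. y - f \<in> Y (J - {k})" using f(1) by (intro bexI[of _ f])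
          qed
        qed
        ultimately show ?thesis by (rule almost_trans)
      qed
      \<comment> \<open>The groups \<open>Y (J - {k})\<close> for \<open>k\<close> in
        \<open>J\<close> intersect in \<open>Y {}\<close>, so member \<open>l\<close> would be
        redundant in the original family.\<close>
      then have "Y {l} \<lesssim> (\<Inter>k\<in>J. Y (J - {k}))"
        using finJ subY by (intro almost_INT)
      moreover have "(\<Inter>k\<in>J. Y (J - {k})) \<subseteq> Y {}" using l by (auto simp: Y_def)
      ultimately have "Y {l} \<lesssim> Y {}" by (rule almost_mono[OF _ order_refl])
      then show False using irr l J(1) by blast
    qed
  qed (rule finJ)
  moreover have "card I = card (I - J) + card J"
    using J(1) insert.prems(1) finJ by (simp add: card_Diff_subset card_mono)
  ultimately show ?case using insert.hyps by (simp add: algebra_simps)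
qed

subsection \<open>Upper bounds for shatter functions\<close>

lemma card_image_factor:
  assumes "finite (f ` A)" "\<And>x y. x \<in> A \<Longrightarrow> y \<in> A \<Longrightarrow> f x = f y \<Longrightarrow> g x = g y"
  shows "card (g ` A) \<le> card (f ` A)"
proof -
  have "g ` A = (\<lambda>z. g (inv_into A f z)) ` f ` A"
    unfolding image_image using assms(2)
    by (intro image_cong refl) (metis f_inv_into_f imageI inv_into_into)
  then show ?thesis using card_image_le[OF assms(1)] by metis
qed

text \<open>A trace is determined by the set of those \<open>H\<close> that are met, by a point of
  \<open>S\<close> for each \<open>H\<close> in an irredundant subfamily of at most \<open>D\<close>
  members, and by one of boundedly many corrections for finite index. Only the choice of points
  depends on \<open>S\<close>, which gives the power \<open>D\<close>.\<close>

lemma card_traces: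
  fixes G :: "'g::ab_group_add set"
  assumes G: "subgrp G" and F: "finite F" "\<And>H. H \<in> F \<Longrightarrow> subgrp H"
    and D: "\<And>J. J \<subseteq> F \<Longrightarrow> irredundant G J (\<lambda>H. H) \<Longrightarrow> card J \<le> D"
  shows "\<exists>C. \<forall>S. finite S \<longrightarrow> S \<noteq> {} \<longrightarrow>
    card ((\<lambda>v. {(s, H). s \<in> S \<and> H \<in> F \<and> s + v \<in> H}) ` G) \<le> C * card S ^ D"
proof -
  have "\<exists>J R. J \<subseteq> F' \<and> card J \<le> D \<and> finite R \<and> (\<forall>x\<in>G \<inter> \<Inter>J. \<exists>r\<in>R. x - r \<in> G \<inter> \<Inter>F')"
    if "F' \<subseteq> F" for F'
  proof -
    have "finite F'" using F(1) that by (rule finite_subset[rotated])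
    then obtain J where J: "J \<subseteq> F'" "G \<inter> (\<Inter>j\<in>J. j) \<lesssim> G \<inter> (\<Inter>j\<in>F'. j)" "irredundant G J (\<lambda>H. H)"
      by (rule irredundant_subfamily)
    obtain R where R: "finite R" "\<forall>x\<in>G \<inter> (\<Inter>j\<in>J. j). \<exists>r\<in>R. x - r \<in> G \<inter> (\<Inter>j\<in>F'. j)"
      using J(2) unfolding almost_in_def by (elim exE conjE)
    have "card J \<le> D" using D J that by blast
    then show ?thesis using J(1) R by (intro exI[of _ J] exI[of _ R]) simp
  qed
  then obtain J R where J: "\<And>F'. F' \<subseteq> F \<Longrightarrow> J F' \<subseteq> F'" "\<And>F'. F' \<subseteq> F \<Longrightarrow> card (J F') \<le> D"
    and R: "\<And>F'. F' \<subseteq> F \<Longrightarrow> finite (R F')"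
      "\<And>F'. F' \<subseteq> F \<Longrightarrow> \<forall>x\<in>G \<inter> \<Inter>(J F'). \<exists>r\<in>R F'. x - r \<in> G \<inter> \<Inter>F'"
    by metis
  have "card ((\<lambda>v. {(s, H). s \<in> S \<and> H \<in> F \<and> s + v \<in> H}) ` G) \<le>
      (\<Sum>F'\<in>Pow F. card (R F')) * card S ^ D" if S: "finite S" "S \<noteq> {}" for S
  proof -
    define Fv where "Fv v = {H \<in> F. \<exists>s\<in>S. s + v \<in> H}" for v
    have Fv: "Fv v \<subseteq> F" for v by (auto simp: Fv_def)
    define \<sigma> where "\<sigma> v = (\<lambda>H\<in>J (Fv v). SOME s. s \<in> S \<and> s + v \<in> H)" for v
    have \<sigma>: "\<sigma> v H \<in> S \<and> \<sigma> v H + v \<in> H" if "H \<in> J (Fv v)" for v H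
    proof -
      have "\<exists>s. s \<in> S \<and> s + v \<in> H" using J(1)[OF Fv] that by (auto simp: Fv_def)
      from someI_ex[OF this] show ?thesis using that by (simp add: \<sigma>_def)
    qed
    \<comment> \<open>A reference element depending only on \<open>Fv v\<close> and
      \<open>\<sigma> v\<close>. Its difference from \<open>v\<close> lies in the intersection of
      the irredundant subfamily, and \<open>\<rho> v\<close> below names the coset of that
      difference modulo the intersection over all of \<open>Fv v\<close>.\<close>
    define base where "base v = (SOME w. w \<in> G \<and> Fv w = Fv v \<and> \<sigma> w = \<sigma> v)" for v
    have base: "base v \<in> G \<and> Fv (base v) = Fv v \<and> \<sigma> (base v) = \<sigma> v" if "v \<in> G" for v
      unfolding base_def using that by (rule someI[of _ v, OF conjI[OF _ conjI]]) simp_all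
    have "\<forall>v\<in>G. \<exists>r\<in>R (Fv v). v - base v - r \<in> G \<inter> \<Inter>(Fv v)"
    proof
      fix v assume v: "v \<in> G"
      have "v - base v \<in> G \<inter> \<Inter>(J (Fv v))"
      proof (intro IntI InterI)
        show "v - base v \<in> G" using subgrp_diff[OF G v] base[OF v] by simp
        fix H assume H: "H \<in> J (Fv v)"
        then have "subgrp H" using J(1)[OF Fv] Fv F(2) by blast
        moreover have "\<sigma> v H + v \<in> H" "\<sigma> v H + base v \<in> H"
          using \<sigma>[of H v] \<sigma>[of H "base v"] H base[OF v] by auto
        ultimately have "(\<sigma> v H + v) - (\<sigma> v H + base v) \<in> H" by (rule subgrp_diff)
        then show "v - base v \<in> H" by simp
      qed
      then show "\<exists>r\<in>R (Fv v). v - base v - r \<in> G \<inter> \<Inter>(Fv v)"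
        by (rule bspec[OF R(2)[OF Fv]])
    qed
    then obtain \<rho> where \<rho>: "\<And>v. v \<in> G \<Longrightarrow> \<rho> v \<in> R (Fv v)"
      "\<And>v. v \<in> G \<Longrightarrow> v - base v - \<rho> v \<in> G \<inter> \<Inter>(Fv v)"
      unfolding Bex_def by metis
    define key where "key v = (Fv v, \<sigma> v, \<rho> v)" for v
    define B where "B = (SIGMA F':Pow F. (J F' \<rightarrow>\<^sub>E S) \<times> R F')"
    have finJ: "finite (J F')" if "F' \<subseteq> F" for F'
      using J(1)[OF that] F(1) that by (meson finite_subset)
    have finB: "finite B"
      unfolding B_def using F(1) R(1) finJ S(1) by (auto intro!: finite_SigmaI finite_PiE)
    have "\<sigma> v \<in> J (Fv v) \<rightarrow>\<^sub>E S" for v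
      using \<sigma>[of _ v] by (auto simp: PiE_iff \<sigma>_def extensional_def)
    then have key: "key ` G \<subseteq> B" using Fv \<rho>(1) by (auto simp: key_def B_def)
    have "card ((\<lambda>v. {(s, H). s \<in> S \<and> H \<in> F \<and> s + v \<in> H}) ` G) \<le> card (key ` G)"
    proof (rule card_image_factor)
      show "finite (key ` G)" using key finB finite_subset by blast
      fix v w assume vw: "v \<in> G" "w \<in> G" "key v = key w"
      have eq: "Fv v = Fv w" "\<sigma> v = \<sigma> w" "\<rho> v = \<rho> w" using vw(3) by (auto simp: key_def)
      then have "base v = base w" by (simp add: base_def)
      have "s + v \<in> H \<longleftrightarrow> s + w \<in> H" if "s \<in> S" "H \<in> F" for s H
      proof (cases "H \<in> Fv v")
        case True
        have subH: "subgrp H" using F(2) that(2) .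
        have "v - base v - \<rho> v \<in> H" "w - base w - \<rho> w \<in> H"
          using \<rho>(2)[OF vw(1)] \<rho>(2)[OF vw(2)] True eq(1) by auto
        then have "(v - base v - \<rho> v) - (w - base w - \<rho> w) \<in> H"
          by (rule subgrp_diff[OF subH])
        then have "v - w \<in> H" using \<open>base v = base w\<close> eq(3) by simp
        from subgrp_add_cancel[OF subH this, of "s + w"] show ?thesis by (simp add: algebra_simps)
      next
        case False
        then have "H \<notin> Fv v" "H \<notin> Fv w" using eq(1) by auto
        then show ?thesis using that by (auto simp: Fv_def)
      qed
      then show "{(s, H). s \<in> S \<and> H \<in> F \<and> s + v \<in> H} = {(s, H). s \<in> S \<and> H \<in> F \<and> s + w \<in> H}"
        by auto
    qed
    also have "\<dots> \<le> card B" using key finB by (rule card_mono[rotated])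
    also have "\<dots> = (\<Sum>F'\<in>Pow F. card S ^ card (J F') * card (R F'))"
      unfolding B_def using F(1) R(1) finJ S(1)
      by (subst card_SigmaI) (auto simp: card_cartesian_product card_PiE finite_PiE intro!: finite_cartesian_product)
    also have "\<dots> \<le> (\<Sum>F'\<in>Pow F. card (R F') * card S ^ D)"
    proof (intro sum_mono)
      fix F' assume "F' \<in> Pow F"
      then have "card S ^ card (J F') \<le> card S ^ D"
        using J(2) S by (intro power_increasing) (auto simp: Suc_le_eq card_gt_0_iff)
      then show "card S ^ card (J F') * card (R F') \<le> card (R F') * card S ^ D" by simp
    qed
    finally show ?thesis by (simp add: sum_distrib_right)
  qed
  then show ?thesis by blast
qed

section \<open>Truth values depend only on the free variables\<close>

lemma trm_val_cong: "(\<And>i. i \<in> trm_vars s \<Longrightarrow> e i = e' i) \<Longrightarrow> trm_val e s = trm_val e' s"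
  by (induction s) auto

lemma sat_cong: "(\<And>i. i \<in> free_vars \<phi> \<Longrightarrow> e i = e' i) \<Longrightarrow> sat e \<phi> \<longleftrightarrow> sat e' \<phi>"
proof (induction \<phi> arbitrary: e e')
  case (Eq s t)
  then show ?case using trm_val_cong[of s e e'] trm_val_cong[of t e e'] by simp
next
  case (Neg \<phi>)
  then show ?case by (metis free_vars.simps(2) sat.simps(2))
next
  case (Conj \<phi> \<psi>)
  have "sat e \<phi> \<longleftrightarrow> sat e' \<phi>" by (rule Conj.IH) (use Conj.prems in auto)
  moreover have "sat e \<psi> \<longleftrightarrow> sat e' \<psi>" by (rule Conj.IH) (use Conj.prems in auto)
  ultimately show ?case by simp
next
  case (Ex i \<phi>)
  have "sat (e(i := a)) \<phi> \<longleftrightarrow> sat (e'(i := a)) \<phi>" for a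
    by (rule Ex.IH) (use Ex.prems in auto)
  then show ?case by simp
qed

text \<open>Quantifier elimination reduces counting definable subsets to counting traces of pp
  subgroups, where the parameter ranges over \<open>supp V\<close>; \<open>irredundant_card\<close>
  supplies the exponent.\<close>

lemma shatter_fun_le:
  assumes part: "partitioned \<phi> k m"
    and base: "\<And>v I. finite I \<Longrightarrow> \<forall>H\<in>I. pp H \<Longrightarrow>
      irredundant (supp {v} :: (nat \<Rightarrow> 'a::ab_group_add) set) I (\<lambda>H. H) \<Longrightarrow> card I \<le> d"
  shows "\<exists>C. \<forall>t>0. shatter_fun TYPE('a) \<phi> k m t \<le> C * t ^ (d * m)"
proof -
  define V where "V = {k..<k + m}"
  obtain F where F: "finite F" "\<And>H. H \<in> F \<Longrightarrow> pp H"
    "\<And>e e' :: nat \<Rightarrow> 'a. (\<And>H. H \<in> F \<Longrightarrow> e \<in> H \<longleftrightarrow> e' \<in> H) \<Longrightarrow> sat e \<phi> \<longleftrightarrow> sat e' \<phi>"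
    using pp_determined_sat[of \<phi>] unfolding pp_determined_def mem_Collect_eq by metis
  have bound: "card I \<le> d * m" if "I \<subseteq> F" "irredundant (supp V) I (\<lambda>H. H)" for I
  proof -
    have "card I \<le> d * card V"
    proof (rule irredundant_card[where H = "\<lambda>H. H"])
      fix v and I :: "(nat \<Rightarrow> 'a) set set" and H :: "(nat \<Rightarrow> 'a) set \<Rightarrow> (nat \<Rightarrow> 'a) set"
      assume I: "finite I" "\<forall>j\<in>I. pp (H j)" "irredundant (supp {v}) I H"
      \<comment> \<open>An indexed family with a repeated member is redundant, so the hypothesis
        about sets of subgroups covers indexed families too.\<close>
      have inj: "inj_on H I"
      proof (rule inj_onI, rule ccontr)
        fix i j assume ij: "i \<in> I" "j \<in> I" "H i = H j" "i \<noteq> j"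
        then have "(\<Inter>j\<in>I - {i}. H j) = (\<Inter>j\<in>I. H j)" by auto
        then show False using I(3) ij(1) by (auto simp: irredundant_def almost_subset)
      qed
      have "(\<Inter>H'\<in>H ` I - {H i}. H') = (\<Inter>j\<in>I - {i}. H j)" if "i \<in> I" for i
      proof -
        have "H ` I - {H i} = H ` (I - {i})" using inj that by (auto simp: inj_on_def)
        then show ?thesis by simp
      qed
      then have "irredundant (supp {v}) (H ` I) (\<lambda>H. H)"
        using I(3) by (auto simp: irredundant_def)
      then have "card (H ` I) \<le> d" using I by (intro base) auto
      then show "card I \<le> d" using inj by (simp add: card_image)
    qed (use that F finite_subset in \<open>auto simp: V_def\<close>)
    then show ?thesis by (simp add: V_def)
  qed
  obtain C where C: "\<And>S. finite S \<Longrightarrow> S \<noteq> {} \<Longrightarrow>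
    card ((\<lambda>v. {(s, H). s \<in> S \<and> H \<in> F \<and> s + v \<in> H}) ` supp V) \<le> C * card S ^ (d * m)"
    using card_traces[OF subgrp_supp F(1) pp_subgrp[OF F(2)] bound] by blast
  \<comment> \<open>Both halves of the tuple are padded with zeros, so that the valuation becomes
    the sum of an \<open>x\<close>-part and a \<open>y\<close>-part.\<close>
  define xs where "xs a = (\<lambda>i. if i < k then a ! i else 0)" for a :: "'a list"
  define ys where "ys b = (\<lambda>i. if i \<in> V then b ! (i - k) else 0)" for b :: "'a list"
  have sat: "sat ((!) (a @ b)) \<phi> \<longleftrightarrow> sat (xs a + ys b) \<phi>"
    if "a \<in> tuples k" "b \<in> tuples m" for a b
    using part that
    by (intro sat_cong) (auto simp: partitioned_def tuples_def xs_def ys_def V_def nth_append)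
  have count: "card ((\<lambda>b. S \<inter> def_set \<phi> k b) ` tuples m) \<le> C * t ^ (d * m)"
    if S: "S \<subseteq> tuples k" "finite S" "card S = t" and t: "t > 0" for S :: "'a list set" and t
  proof -
    let ?tr = "\<lambda>v. {(s, H). s \<in> xs ` S \<and> H \<in> F \<and> s + v \<in> H}"
    have "finite (?tr ` supp V)"
      by (rule finite_subset[of _ "Pow (xs ` S \<times> F)"]) (use S F(1) in auto)
    moreover have sub: "?tr ` ys ` tuples m \<subseteq> ?tr ` supp V"
      by (intro image_mono) (auto simp: ys_def supp_def)
    ultimately have fin: "finite ((?tr \<circ> ys) ` tuples m)"
      unfolding image_comp[symmetric] by (rule finite_subset[rotated])
    have "card ((\<lambda>b. S \<inter> def_set \<phi> k b) ` tuples m) \<le> card ((?tr \<circ> ys) ` tuples m)"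
    proof (rule card_image_factor[OF fin])
      fix b b' assume b: "b \<in> tuples m" "b' \<in> tuples m" "(?tr \<circ> ys) b = (?tr \<circ> ys) b'"
      have "sat (xs a + ys b) \<phi> \<longleftrightarrow> sat (xs a + ys b') \<phi>" if "a \<in> S" for a
      proof (rule F(3))
        fix H assume "H \<in> F"
        have "(xs a, H) \<in> (?tr \<circ> ys) b \<longleftrightarrow> (xs a, H) \<in> (?tr \<circ> ys) b'" by (simp only: b(3))
        then show "xs a + ys b \<in> H \<longleftrightarrow> xs a + ys b' \<in> H" using \<open>H \<in> F\<close> that by simp
      qed
      then show "S \<inter> def_set \<phi> k b = S \<inter> def_set \<phi> k b'"
        using sat b(1,2) S(1) by (auto simp: def_set_def)
    qed
    also have "\<dots> \<le> card (?tr ` supp V)"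
      unfolding image_comp[symmetric] using \<open>finite (?tr ` supp V)\<close> sub by (rule card_mono)
    also have "\<dots> \<le> C * card (xs ` S) ^ (d * m)"
      using S t by (intro C) auto
    also have "\<dots> \<le> C * t ^ (d * m)"
      using card_image_le[OF S(2), of xs] S(3) by (intro mult_le_mono power_mono) auto
    finally show ?thesis .
  qed
  have "shatter_fun TYPE('a) \<phi> k m t \<le> C * t ^ (d * m)" if "t > 0" for t
  proof (cases "{S :: 'a list set. S \<subseteq> tuples k \<and> finite S \<and> card S = t} = {}")
    case True
    then show ?thesis unfolding shatter_fun_def by (simp only: image_empty Sup_nat_empty)
  next
    case False
    then show ?thesis
      unfolding shatter_fun_def using count that by (intro cSUP_least) auto
  qed
  then show ?thesis by blast
qed

lemma vc_fun_le:
  assumes "\<And>v I. finite I \<Longrightarrow> \<forall>H\<in>I. pp H \<Longrightarrow>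
      irredundant (supp {v} :: (nat \<Rightarrow> 'a::ab_group_add) set) I (\<lambda>H. H) \<Longrightarrow> card I \<le> d"
  shows "vc_fun TYPE('a) m \<le> ereal (real (d * m))"
  unfolding vc_fun_def
proof (rule SUP_least, clarify)
  fix \<phi> k assume part: "partitioned \<phi> k m"
  have "\<exists>C. \<forall>t>0. shatter_fun TYPE('a) \<phi> k m t \<le> C * t ^ (d * m)"
    by (rule shatter_fun_le[OF part]) (rule assms)
  then obtain C where C: "\<And>t. t > 0 \<Longrightarrow> shatter_fun TYPE('a) \<phi> k m t \<le> C * t ^ (d * m)"
    by blast
  have "(\<lambda>t. real (shatter_fun TYPE('a) \<phi> k m t)) \<in> O(\<lambda>t. real t powr real (d * m))"
  proof (rule bigoI[of _ "real C"])
    have "real (shatter_fun TYPE('a) \<phi> k m t) \<le> real C * real t powr real (d * m)" if "t > 0" for t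
      using C[OF that] that by (simp only: powr_realpow of_nat_0_less_iff flip: of_nat_power of_nat_mult)
    then show "\<forall>\<^sub>F t in sequentially. norm (real (shatter_fun TYPE('a) \<phi> k m t)) \<le>
        real C * norm (real t powr real (d * m))"
      by (intro eventually_mono[OF eventually_gt_at_top[of 0]]) simp
  qed
  then show "vc_density TYPE('a) \<phi> k m \<le> ereal (real (d * m))"
    unfolding vc_density_def by (intro INF_lower) simp
qed

subsection \<open>Divisibility in an abelian group\<close>

definition dvdg :: "int \<Rightarrow> 'a::ab_group_add \<Rightarrow> bool" where
  "dvdg d a \<longleftrightarrow> (\<exists>z. zs d z = a)"

lemma dvdg_zs_self: "dvdg d (zs d a)"
  by (auto simp: dvdg_def)

lemma dvdg_zs: "dvdg d a \<Longrightarrow> dvdg d (zs n a)"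
  unfolding dvdg_def by (metis zs_mult_commute)

lemma dvdg_diff: "dvdg d a \<Longrightarrow> dvdg d b \<Longrightarrow> dvdg d (a - b)"
  unfolding dvdg_def by (metis zs.scale_right_diff_distrib)

lemma dvdg_0 [simp]: "dvdg d 0"
  unfolding dvdg_def by (intro exI[of _ 0]) simp

lemma dvdg_zero_iff [simp]: "dvdg 0 a \<longleftrightarrow> a = 0"
  by (auto simp: dvdg_def)

lemma dvdg_add: "dvdg d a \<Longrightarrow> dvdg d b \<Longrightarrow> dvdg d (a + b)"
  unfolding dvdg_def by (metis zs.scale_right_distrib)

lemma dvdg_add_iff: "dvdg d b \<Longrightarrow> dvdg d (a + b) \<longleftrightarrow> dvdg d a"
  using dvdg_add[of d a b] dvdg_diff[of d "a + b" b] by auto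

lemma dvdg_sum:
  fixes g :: "'i \<Rightarrow> 'a::ab_group_add"
  shows "(\<And>i. i \<in> I \<Longrightarrow> dvdg d (g i)) \<Longrightarrow> dvdg d (\<Sum>i\<in>I. g i)"
  by (induction I rule: infinite_finite_induct) (auto intro: dvdg_add)

lemma dvdg_dvd: "dvdg d a \<Longrightarrow> d' dvd d \<Longrightarrow> dvdg d' a"
  unfolding dvdg_def dvd_def by (metis zs.scale_scale)

lemma dvdg_zs_dvd: "d dvd b \<Longrightarrow> dvdg d (zs b a)"
  unfolding dvdg_def dvd_def by (metis zs.scale_scale)

lemma bezout_zs:
  assumes "coprime m n"
  obtains u v where "\<And>a :: 'a::ab_group_add. a = zs (u * m) a + zs (v * n) a"
proof -
  obtain u v where "u * m + v * n = gcd m n" using bezout_int by blast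
  then have "u * m + v * n = 1" using assms by simp
  then have "a = zs (u * m) a + zs (v * n) a" for a :: 'a
    by (metis zs.scale_left_distrib zs.scale_one)
  then show ?thesis by (rule that)
qed

lemma dvdg_zs_cancel:
  assumes "dvdg d (zs n a)" "coprime d n"
  shows "dvdg d (a :: 'a::ab_group_add)"
proof -
  obtain u v where uv: "\<And>a :: 'a. a = zs (u * d) a + zs (v * n) a"
    using bezout_zs[OF assms(2)] by blast
  have "dvdg d (zs (u * d) a)" by (simp add: dvdg_zs_dvd)
  moreover have "dvdg d (zs (v * n) a)" using dvdg_zs[OF assms(1), of v] by simp
  ultimately show ?thesis by (subst uv) (rule dvdg_add)
qed

lemma dvdg_mult_coprime:
  assumes "dvdg m a" "dvdg n a" "coprime m n"
  shows "dvdg (m * n) (a :: 'a::ab_group_add)"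
proof -
  obtain u v where uv: "\<And>a :: 'a. a = zs (u * m) a + zs (v * n) a"
    using bezout_zs[OF assms(3)] by blast
  obtain x y where xy: "zs m x = a" "zs n y = a" using assms unfolding dvdg_def by blast
  have "zs (u * m) (zs n y) = zs (m * n) (zs u y)" "zs (v * n) (zs m x) = zs (m * n) (zs v x)"
    by (simp_all add: ac_simps)
  then have "zs (u * m) a = zs (m * n) (zs u y)" "zs (v * n) a = zs (m * n) (zs v x)"
    by (simp_all only: xy)
  then show ?thesis by (subst uv) (simp only: dvdg_add dvdg_zs_self)
qed

text \<open>Powers of distinct primes are coprime, so \<open>dvdg_mult_coprime\<close> combines
  them; this allows one prime to be treated at a time.\<close>

lemma dvdg_prime_powers:
  assumes "d \<noteq> 0" "\<And>p. p \<in> prime_factors d \<Longrightarrow> dvdg (p ^ multiplicity p d) a"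
  shows "dvdg d a"
proof -
  have "dvdg (\<Prod>p\<in>S. p ^ multiplicity p d) a"
    if "finite S" "S \<subseteq> prime_factors d" for S
    using that
  proof (induction S)
    case empty
    then show ?case by (simp add: dvdg_def)
  next
    case (insert p S)
    have "coprime (p ^ multiplicity p d) (\<Prod>p\<in>S. p ^ multiplicity p d)"
    proof (rule prod_coprime_right)
      fix q assume "q \<in> S"
      then have "prime p" "prime q" "p \<noteq> q" using insert.prems insert.hyps by auto
      then show "coprime (p ^ multiplicity p d) (q ^ multiplicity q d)"
        by (simp add: primes_coprime)
    qed
    then show ?case using insert assms(2) by (simp add: dvdg_mult_coprime)
  qed
  from this[of "prime_factors d"] have "dvdg (normalize d) a"
    using assms(1) by (simp add: prod_prime_factors)
  then show ?thesis by (rule dvdg_dvd) simp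
qed

text \<open>\<open>cond 0 b\<close> is the torsion subgroup \<open>A[b]\<close> and
  \<open>cond d 1\<close> is \<open>dA\<close>. A pp subgroup restricted to a coordinate axis is a
  finite intersection of such subgroups.\<close>

definition cond :: "int \<Rightarrow> int \<Rightarrow> 'a::ab_group_add set" where
  "cond d b = {a. dvdg d (zs b a)}"

lemma subgrp_cond: "subgrp (cond d b)"
  by (auto simp: subgrp_def cond_def zs.scale_right_diff_distrib dvdg_diff)

section \<open>Images and preimages under homomorphisms, up to finite index\<close>

lemma almost_image:
  assumes "X \<lesssim> Y" "\<And>a b. h (a - b) = h a - h b"
  shows "h ` X \<lesssim> h ` Y"
proof -
  obtain F where F: "finite F" "\<forall>x\<in>X. \<exists>f\<in>F. x - f \<in> Y"
    using assms(1) unfolding almost_in_def by auto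
  have "\<exists>f\<in>h ` F. h x - f \<in> h ` Y" if x: "x \<in> X" for x
  proof -
    obtain f where "f \<in> F" "x - f \<in> Y" using bspec[OF F(2) x] by auto
    then show ?thesis by (intro bexI[of _ "h f"]) (auto simp flip: assms(2))
  qed
  then show ?thesis using F(1) by (intro almost_inI[of "h ` F"]) auto
qed

lemma almost_vimage:
  assumes "X \<lesssim> Y" "subgrp Y" "\<And>a b. h (a - b) = h a - h b"
  shows "h -` X \<lesssim> h -` Y"
proof -
  obtain F where F: "finite F" "\<forall>x\<in>X. \<exists>f\<in>F. x - f \<in> Y"
    using assms(1) unfolding almost_in_def by auto
  define r where "r f = (SOME a. h a - f \<in> Y)" for f
  show ?thesis
  proof (rule almost_inI[of "r ` F"])
    fix a assume "a \<in> h -` X"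
    then obtain f where f: "f \<in> F" "h a - f \<in> Y" using bspec[OF F(2), of "h a"] by auto
    have "h (r f) - f \<in> Y" unfolding r_def using f(2) by (rule someI)
    with f(2) have "(h a - f) - (h (r f) - f) \<in> Y" by (rule subgrp_diff[OF assms(2)])
    then have "a - r f \<in> h -` Y" by (simp add: assms(3))
    then show "\<exists>f\<in>r ` F. a - f \<in> h -` Y" using f(1) by blast
  qed (use F(1) in simp)
qed

lemma subgrp_singleton_0: "subgrp {0}"
  by (simp add: subgrp_def)

text \<open>Induction over the prime factors: \<open>A[pn]\<close> is the preimage of
  \<open>A[p]\<close> under multiplication by \<open>n\<close>, and \<open>pnA\<close> is the image
  of \<open>nA\<close> under multiplication by \<open>p\<close>.\<close>

lemma torsion_and_quotient_small:
  assumes "n \<noteq> 0"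
    and "\<And>p. prime p \<Longrightarrow> p dvd n \<Longrightarrow>
      {a :: 'a::ab_group_add. zs p a = 0} \<lesssim> {0} \<and> (UNIV :: 'a set) \<lesssim> range (zs p)"
  shows "{a :: 'a. zs n a = 0} \<lesssim> {0} \<and> (UNIV :: 'a set) \<lesssim> range (zs n)"
  using assms
proof (induction n rule: prime_divisors_induct)
  case zero
  then show ?case by simp
next
  case (unit n)
  then consider "n = 1" | "n = - 1" by fastforce
  then have "n * n = 1" by cases auto
  then have inv: "zs n (zs n a) = a" for a :: 'a by simp
  have "{a :: 'a. zs n a = 0} \<subseteq> {0}"
    using inv by (metis (mono_tags, lifting) mem_Collect_eq singleton_iff subsetI zs.scale_zero_right)
  moreover have "(UNIV :: 'a set) \<subseteq> range (zs n)"
    using inv by (metis rangeI subsetI)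
  ultimately show ?case by (simp add: almost_subset)
next
  case (factor p n)
  then have IH: "{a :: 'a. zs n a = 0} \<lesssim> {0}" "(UNIV :: 'a set) \<lesssim> range (zs n)" by auto
  have p: "{a :: 'a. zs p a = 0} \<lesssim> {0}" "(UNIV :: 'a set) \<lesssim> range (zs p)"
    using factor by auto
  have "zs n -` {a :: 'a. zs p a = 0} \<lesssim> zs n -` {0 :: 'a}"
    by (rule almost_vimage[OF p(1) subgrp_singleton_0 zs.scale_right_diff_distrib])
  moreover have "zs n -` {a :: 'a. zs p a = 0} = {a. zs (p * n) a = 0}"
    "zs n -` {0 :: 'a} = {a. zs n a = 0}" by auto
  ultimately have "{a :: 'a. zs (p * n) a = 0} \<lesssim> {0}" using almost_trans IH(1) by metis
  moreover have "zs p ` (UNIV :: 'a set) \<lesssim> zs p ` range (zs n)"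
    by (rule almost_image[OF IH(2) zs.scale_right_diff_distrib])
  then have "(UNIV :: 'a set) \<lesssim> range (zs (p * n))"
    using almost_trans[OF p(2)] by (simp add: image_image)
  ultimately show ?case by simp
qed


subsection \<open>Subgroups of a singular prime\<close>

text \<open>The subgroup \<open>p^n A + A[p^l]\<close>, which is also the solution set of the
  condition that \<open>p^(n+l)\<close> divides \<open>p^l a\<close>.\<close>

definition div_tor :: "int \<Rightarrow> nat \<Rightarrow> nat \<Rightarrow> 'a::ab_group_add set" where
  "div_tor p n l = {zs (p ^ n) x + y | x y. zs (p ^ l) y = 0}"

lemma div_tor_mono:
  assumes "n \<le> n'" "l' \<le> l"
  shows "div_tor p n' l' \<subseteq> (div_tor p n l :: 'a::ab_group_add set)"
proof -
  have n: "zs (p ^ n') x = zs (p ^ n) (zs (p ^ (n' - n)) x)" for x :: 'a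
    using assms(1) by (simp flip: power_add)
  have l: "zs (p ^ l) y = 0" if "zs (p ^ l') y = 0" for y :: 'a
  proof -
    have "zs (p ^ l) y = zs (p ^ (l - l')) (zs (p ^ l') y)"
      using assms(2) by (simp flip: power_add)
    then show ?thesis using that by simp
  qed
  show ?thesis
  proof
    fix a :: 'a assume "a \<in> div_tor p n' l'"
    then obtain x y where "a = zs (p ^ n') x + y" "zs (p ^ l') y = 0"
      unfolding div_tor_def by blast
    then have "a = zs (p ^ n) (zs (p ^ (n' - n)) x) + y" "zs (p ^ l) y = 0"
      using n l by auto
    then show "a \<in> div_tor p n l" unfolding div_tor_def by blast
  qed
qed

lemma div_tor_absorb:
  assumes "{y :: 'a::ab_group_add. zs (p ^ l) y = 0} \<lesssim> div_tor p n l'"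
  shows "div_tor p n l \<lesssim> (div_tor p n l' :: 'a set)"
proof -
  obtain F where F: "finite F" "\<forall>y\<in>{y :: 'a. zs (p ^ l) y = 0}. \<exists>f\<in>F. y - f \<in> div_tor p n l'"
    using assms unfolding almost_in_def by auto
  show ?thesis
  proof (rule almost_inI[OF F(1)])
    fix a :: 'a assume "a \<in> div_tor p n l"
    then obtain x y where a: "a = zs (p ^ n) x + y" "y \<in> {y. zs (p ^ l) y = 0}"
      unfolding div_tor_def by blast
    obtain f where f: "f \<in> F" "y - f \<in> div_tor p n l'" using bspec[OF F(2) a(2)] by auto
    then obtain x' y' where "y - f = zs (p ^ n) x' + y'" "zs (p ^ l') y' = 0"
      unfolding div_tor_def by blast
    then have "a - f = zs (p ^ n) (x + x') + y' \<and> zs (p ^ l') y' = 0"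
      using a(1) by (simp add: zs.scale_right_distrib add.assoc flip: add_diff_eq)
    then show "\<exists>f\<in>F. a - f \<in> div_tor p n l'"
      using f(1) unfolding div_tor_def by blast
  qed
qed

text \<open>The group \<open>(p^i A)[p]\<close> from the Ulm invariants, in terms of integer
  scalars.\<close>

definition ulm_part :: "int \<Rightarrow> nat \<Rightarrow> 'a::ab_group_add set" where
  "ulm_part p i = {c. dvdg (p ^ i) c \<and> zs p c = 0}"

lemma subgrp_ulm_part: "subgrp (ulm_part p i)"
  by (auto simp: subgrp_def ulm_part_def dvdg_diff zs.scale_right_diff_distrib)

text \<open>Torsion exponents above \<open>N\<close> can be lowered one at a time. Multiplication by
  \<open>p^(N+j)\<close> sends \<open>A[p^(N+j+1)]\<close> into \<open>(p^N A)[p]\<close>, which is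
  almost contained in \<open>p^(N+j+n) A\<close>; an element sent there differs from an element of
  \<open>p^n A\<close> by one of \<open>A[p^(N+j)]\<close>.\<close>

lemma div_tor_stable:
  assumes U: "\<And>i. N \<le> i \<Longrightarrow> (ulm_part p i :: 'a::ab_group_add set) \<lesssim> ulm_part p (Suc i)"
  shows "div_tor p n l \<lesssim> (div_tor p n (min l N) :: 'a set)"
proof -
  have U': "(ulm_part p N :: 'a set) \<lesssim> ulm_part p (N + m)" for m
  proof (induction m)
    case 0
    then show ?case by (simp add: almost_subset)
  next
    case (Suc m)
    then show ?case using almost_trans[OF Suc U[of "N + m"]] by simp
  qed
  have tor: "{y :: 'a. zs (p ^ (N + j)) y = 0} \<lesssim> div_tor p n N" for j
  proof (induction j)
    case 0
    have "\<exists>x z. y = zs (p ^ n) x + z \<and> zs (p ^ N) z = 0" if "zs (p ^ N) y = 0" for y :: 'a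
      using that by (intro exI[of _ 0] exI[of _ y]) simp
    then show ?case unfolding div_tor_def by (intro almost_subset) auto
  next
    case (Suc j)
    let ?h = "zs (p ^ (N + j)) :: 'a \<Rightarrow> 'a"
    have "{y :: 'a. zs (p ^ (N + Suc j)) y = 0} \<subseteq> ?h -` ulm_part p N"
      by (auto simp: ulm_part_def power_add dvdg_zs_dvd mult.assoc)
    moreover have "?h -` ulm_part p N \<lesssim> ?h -` ulm_part p (N + (j + n))"
      by (rule almost_vimage[OF U' subgrp_ulm_part zs.scale_right_diff_distrib])
    moreover have "?h -` ulm_part p (N + (j + n)) \<subseteq> div_tor p n (N + j)"
    proof
      fix a assume "a \<in> ?h -` ulm_part p (N + (j + n))"
      then obtain x where "zs (p ^ (N + (j + n))) x = zs (p ^ (N + j)) a"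
        by (auto simp: ulm_part_def dvdg_def)
      then have "zs (p ^ (N + j)) (a - zs (p ^ n) x) = 0"
        by (simp add: zs.scale_right_diff_distrib power_add mult.assoc)
      moreover have "a = zs (p ^ n) x + (a - zs (p ^ n) x)" by simp
      ultimately show "a \<in> div_tor p n (N + j)" unfolding div_tor_def by blast
    qed
    moreover have "div_tor p n (N + j) \<lesssim> (div_tor p n N :: 'a set)"
      by (rule div_tor_absorb[OF Suc])
    ultimately show ?case by (meson almost_subset almost_trans)
  qed
  show ?thesis
  proof (cases "l \<le> N")
    case True
    then show ?thesis by (simp add: almost_subset)
  next
    case False
    then show ?thesis using div_tor_absorb[OF tor[of "l - N"]] by simp
  qed
qed

text \<open>The part of \<open>b\<close> prime to \<open>p\<close> can be cancelled. What remains
  says that \<open>p^k\<close> divides \<open>p^l a\<close>, where \<open>k\<close> and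
  \<open>l\<close> are the two multiplicities, and subtracting a multiple of \<open>p^(k-l)\<close>
  leaves an element of \<open>A[p^l]\<close>.\<close>

lemma cond_subset_div_tor:
  assumes "prime p" "d \<noteq> 0" "b \<noteq> 0" "multiplicity p b \<le> multiplicity p d"
  shows "cond d b \<subseteq> div_tor p (multiplicity p d - multiplicity p b) (multiplicity p b)"
proof
  fix a :: 'a assume a: "a \<in> cond d b"
  let ?k = "multiplicity p d" and ?l = "multiplicity p b"
  obtain b' where b': "b = p ^ ?l * b'" "\<not> p dvd b'"
    using multiplicity_decompose'[of b p] assms(1,3) not_prime_unit by blast
  have "dvdg (p ^ ?k) (zs b a)"
    using a multiplicity_dvd[of p d] by (auto simp: cond_def intro: dvdg_dvd)
  then have "dvdg (p ^ ?k) (zs b' (zs (p ^ ?l) a))"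
    using b'(1) by (metis mult.commute zs.scale_scale)
  then have "dvdg (p ^ ?k) (zs (p ^ ?l) a)"
    by (rule dvdg_zs_cancel) (use assms(1) b'(2) in \<open>auto simp: prime_imp_coprime\<close>)
  then obtain z where z: "zs (p ^ ?k) z = zs (p ^ ?l) a" by (auto simp: dvdg_def)
  have "zs (p ^ ?l) (a - zs (p ^ (?k - ?l)) z) = 0"
    using z assms(4) by (simp add: zs.scale_right_diff_distrib flip: power_add)
  moreover have "a = zs (p ^ (?k - ?l)) z + (a - zs (p ^ (?k - ?l)) z)" by simp
  ultimately show "a \<in> div_tor p (?k - ?l) ?l" unfolding div_tor_def by blast
qed

lemma div_tor_subset_cond:
  assumes "p ^ l dvd b" "k \<le> n + l"
  shows "div_tor p n l \<subseteq> cond (p ^ k) b"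
proof
  fix a :: 'a assume "a \<in> div_tor p n l"
  then obtain x y where a: "a = zs (p ^ n) x + y" "zs (p ^ l) y = 0"
    unfolding div_tor_def by blast
  obtain c where c: "b = p ^ l * c" using assms(1) by blast
  have "zs b y = zs c (zs (p ^ l) y)" by (simp add: c mult.commute)
  then have "zs b a = zs (b * p ^ n) x" using a by (simp add: zs.scale_right_distrib)
  moreover have "p ^ k dvd p ^ (n + l)" using assms(2) by (rule le_imp_power_dvd)
  then have "p ^ k dvd b * p ^ n" unfolding c by (simp add: power_add ac_simps)
  ultimately show "a \<in> cond (p ^ k) b" by (simp add: cond_def dvdg_zs_dvd)
qed


subsection \<open>Finite breadth\<close>

lemma zs_Gcd:
  assumes "finite B" "\<And>b. b \<in> B \<Longrightarrow> zs b a = 0"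
  shows "zs (Gcd B) a = (0 :: 'a::ab_group_add)"
  using assms
proof (induction B)
  case (insert b B)
  obtain u v where "u * b + v * Gcd B = gcd b (Gcd B)" using bezout_int by blast
  then have "zs (gcd b (Gcd B)) a = zs u (zs b a) + zs v (zs (Gcd B) a)"
    by (metis zs.scale_left_distrib zs.scale_scale)
  then show ?case using insert by simp
qed simp

text \<open>For each \<open>p\<close> in \<open>P\<close> it is enough to keep an element of
  \<open>B\<close> of least \<open>p\<close>-multiplicity. Then the gcd of the kept elements divides
  every \<open>b\<close> in \<open>B\<close> up to a factor \<open>n\<close> without prime divisors
  in \<open>P\<close>, and \<open>A[n]\<close> is finite.\<close>

lemma torsion_conditions:
  fixes P :: "int set"
  assumes P: "finite P" "\<And>p. p \<in> P \<Longrightarrow> prime p"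
    and small: "\<And>p. prime p \<Longrightarrow> p \<notin> P \<Longrightarrow> {a :: 'a::ab_group_add. zs p a = 0} \<lesssim> {0}
       \<and> (UNIV :: 'a set) \<lesssim> range (zs p)"
    and B: "finite B" "0 \<notin> B"
  shows "\<exists>B'\<subseteq>B. card B' \<le> card P + 1 \<and> (\<forall>b\<in>B. {a :: 'a. \<forall>b\<in>B'. zs b a = 0} \<lesssim> {a. zs b a = 0})"
proof (cases "B = {}")
  case False
  define f where "f p = arg_min_on (multiplicity p) B" for p
  have f: "f p \<in> B" "\<And>b. b \<in> B \<Longrightarrow> multiplicity p (f p) \<le> multiplicity p b" for p
    unfolding f_def using arg_min_if_finite(1)[OF B(1) False] arg_min_least[OF B(1) False] by auto
  obtain b0 where b0: "b0 \<in> B" using False by blast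
  \<comment> \<open>The extra element \<open>b0\<close> keeps the gcd nonzero even if
    \<open>P\<close> is empty.\<close>
  define B' where "B' = insert b0 (f ` P)"
  have B': "B' \<subseteq> B" "finite B'" "b0 \<in> B'" using f b0 P(1) by (auto simp: B'_def)
  have "{a :: 'a. \<forall>b\<in>B'. zs b a = 0} \<lesssim> {a. zs b a = 0}" if b: "b \<in> B" for b
  proof -
    define g where "g = Gcd B'"
    have g0: "g \<noteq> 0" using B' B(2) by (auto simp: g_def)
    define n where "n = g div gcd g b"
    have g: "g = n * gcd g b" by (simp add: n_def)
    then have n0: "n \<noteq> 0" using g0 by auto
    have P_n: "\<not> p dvd n" if p: "p \<in> P" for p
    proof
      assume pn: "p dvd n"
      let ?l = "multiplicity p g"
      have "g dvd f p" unfolding g_def using p by (intro Gcd_dvd) (auto simp: B'_def)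
      moreover have "f p \<noteq> 0" using f(1) B(2) by metis
      ultimately have "?l \<le> multiplicity p b"
        using f(2)[OF b, of p] dvd_imp_multiplicity_le[of g "f p" p] by simp
      then have "p ^ ?l dvd gcd g b" by (simp add: multiplicity_dvd multiplicity_dvd')
      then have "p ^ Suc ?l dvd g" using pn by (subst g) (simp add: mult_dvd_mono)
      then show False
        using g0 P(2)[OF p] multiplicity_geI[of g p "Suc ?l"] not_prime_unit by fastforce
    qed
    have small_n: "{c :: 'a. zs n c = 0} \<lesssim> {0}"
      using torsion_and_quotient_small[OF n0] small P_n by blast
    have "zs b -` {c :: 'a. zs n c = 0} \<lesssim> zs b -` {0}"
      by (rule almost_vimage[OF small_n subgrp_singleton_0 zs.scale_right_diff_distrib])
    moreover have "{a :: 'a. \<forall>b\<in>B'. zs b a = 0} \<subseteq> zs b -` {c. zs n c = 0}"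
    proof
      fix a :: 'a assume "a \<in> {a. \<forall>b\<in>B'. zs b a = 0}"
      then have "zs g a = 0" unfolding g_def using B'(2) by (intro zs_Gcd) auto
      moreover have "g dvd n * b" by (subst g) simp
      then obtain c where "n * b = c * g" by (metis dvd_div_mult_self)
      ultimately have "zs (n * b) a = 0" by (simp flip: zs.scale_scale)
      then show "a \<in> zs b -` {c. zs n c = 0}" by simp
    qed
    ultimately show ?thesis by (rule almost_mono) auto
  qed
  moreover have "card B' \<le> card P + 1"
    unfolding B'_def using P(1) card_image_le[OF P(1), of f] card_insert_le_m1
    by (metis Suc_eq_plus1 Suc_le_mono card_insert_le_m1 card_insert_if finite_imageI le_SucI)
  ultimately show ?thesis using B'(1) by blast
qed simp

text \<open>Primes outside \<open>P\<close> contribute only finite index. For \<open>p\<close> in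
  \<open>P\<close> the conditions are sorted by the \<open>p\<close>-multiplicity of
  \<open>b\<close>, cut off at \<open>N p\<close> thanks to \<open>div_tor_stable\<close>. In each
  of these \<open>N p + 1\<close> classes one condition implies the \<open>p\<close>-parts of the
  others up to finite index.\<close>

lemma divisibility_conditions:
  fixes P :: "int set" and N :: "int \<Rightarrow> nat"
  assumes P: "finite P" "\<And>p. p \<in> P \<Longrightarrow> prime p"
    and small: "\<And>p. prime p \<Longrightarrow> p \<notin> P \<Longrightarrow> {a :: 'a::ab_group_add. zs p a = 0} \<lesssim> {0}
       \<and> (UNIV :: 'a set) \<lesssim> range (zs p)"
    and U: "\<And>p i. p \<in> P \<Longrightarrow> N p \<le> i \<Longrightarrow> (ulm_part p i :: 'a set) \<lesssim> ulm_part p (Suc i)"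
    and W: "finite W" "\<And>d b. (d, b) \<in> W \<Longrightarrow> d \<noteq> 0 \<and> b \<noteq> 0"
  shows "\<exists>W'\<subseteq>W. card W' \<le> (\<Sum>p\<in>P. N p + 1) \<and>
    (\<forall>(d, b)\<in>W. (\<Inter>(d, b)\<in>W'. cond d b) \<lesssim> (cond d b :: 'a set))"
proof -
  define K where "K = (SIGMA p:P. {..N p})"
  define cl where "cl = (\<lambda>(p, l). {w \<in> W. min (multiplicity p (snd w)) (N p) = l})"
  \<comment> \<open>The exponent \<open>n\<close> in the group \<open>p^n A + A[p^l]\<close>
    belonging to the condition; truncated subtraction gives 0 when the condition is void at
    \<open>p\<close>.\<close>
  define ht where "ht p w = multiplicity p (fst w) - multiplicity p (snd w)" for p and w :: "int \<times> int"
  define f where "f = (\<lambda>(p, l). arg_max_on (ht p) (cl (p, l)))"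
  have f: "f (p, l) \<in> cl (p, l)" "ht p w \<le> ht p (f (p, l))" if "w \<in> cl (p, l)" for p l w
  proof -
    have fin: "finite (cl (p, l))" using W(1) by (simp add: cl_def)
    then have "\<forall>y. y \<in> cl (p, l) \<longrightarrow> ht p y < Suc (Max (ht p ` cl (p, l)))"
      by (simp add: less_Suc_eq_le)
    with that have "f (p, l) \<in> cl (p, l) \<and> (\<forall>y. y \<in> cl (p, l) \<longrightarrow> ht p y \<le> ht p (f (p, l)))"
      unfolding f_def arg_max_on_def case_prod_conv by (rule arg_max_nat_lemma)
    then show "f (p, l) \<in> cl (p, l)" "ht p w \<le> ht p (f (p, l))"
      using that by blast+
  qed
  define W' where "W' = f ` {\<kappa> \<in> K. cl \<kappa> \<noteq> {}}"
  have finK: "finite K" using P(1) by (simp add: K_def)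
  have "card W' \<le> card K"
    unfolding W'_def using card_image_le[of "{\<kappa> \<in> K. cl \<kappa> \<noteq> {}}" f] finK
    by (intro order.trans[OF card_image_le card_mono]) auto
  also have "card K = (\<Sum>p\<in>P. N p + 1)" using P(1) by (simp add: K_def)
  finally have card: "card W' \<le> (\<Sum>p\<in>P. N p + 1)" .
  have sub: "W' \<subseteq> W" using f(1) by (fastforce simp: W'_def cl_def)
  have "(\<Inter>(d, b)\<in>W'. cond d b) \<lesssim> (cond d b :: 'a set)" if db: "(d, b) \<in> W" for d b
  proof -
    have nz: "d \<noteq> 0" "b \<noteq> 0" using W(2)[OF db] by auto
    have "(\<Inter>(d, b)\<in>W'. cond d b) \<lesssim> (cond (p ^ multiplicity p d) b :: 'a set)"
      if p: "p \<in> prime_factors d" for p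
    proof -
      have prime: "prime p" using p by auto
      let ?k = "multiplicity p d" and ?l = "multiplicity p b"
      consider "p \<notin> P" | "?k \<le> ?l" | "p \<in> P" "?l < ?k" by linarith
      then show ?thesis
      proof cases
        case 1
        have "(UNIV :: 'a set) \<lesssim> range (zs (p ^ ?k))"
        proof (rule conjunct2[OF torsion_and_quotient_small])
          show "p ^ ?k \<noteq> 0" using prime by auto
          fix q assume "prime q" "q dvd p ^ ?k"
          then have "q = p" using prime by (metis prime_dvd_power primes_dvd_imp_eq)
          then show "{a :: 'a. zs q a = 0} \<lesssim> {0} \<and> (UNIV :: 'a set) \<lesssim> range (zs q)"
            using small[OF prime 1] by simp
        qed
        moreover have "range (zs (p ^ ?k)) \<subseteq> (cond (p ^ ?k) b :: 'a set)"
          by (auto simp: cond_def dvdg_zs_dvd)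
        ultimately show ?thesis by (rule almost_mono[OF _ subset_UNIV])
      next
        case 2
        then have "p ^ ?k dvd b" by (rule multiplicity_dvd')
        then have "cond (p ^ ?k) b = (UNIV :: 'a set)" by (auto simp: cond_def dvdg_zs_dvd)
        then show ?thesis by (simp add: almost_subset)
      next
        case 3
        define l where "l = min ?l (N p)"
        have cl: "(d, b) \<in> cl (p, l)" using db by (simp add: cl_def l_def)
        obtain d' b' where w': "f (p, l) = (d', b')" by fastforce
        have "(p, l) \<in> K" using 3 by (simp add: K_def l_def)
        then have W': "(d', b') \<in> W'" using cl w' by (force simp: W'_def)
        then have nz': "d' \<noteq> 0" "b' \<noteq> 0" using sub W(2) by auto
        have l: "l = min (multiplicity p b') (N p)" using f(1)[OF cl] w' by (simp add: cl_def)
        define n where "n = multiplicity p d' - multiplicity p b'"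
        have n: "?k - ?l \<le> n" using f(2)[OF cl] w' by (simp add: ht_def n_def)
        \<comment> \<open>A chain from the selected condition to the given one. The second link
          lowers the torsion exponent to the cut-off \<open>l\<close>, which costs finite index; the
          third uses that the selected height is at least as large.\<close>
        have "(cond d' b' :: 'a set) \<subseteq> div_tor p n (multiplicity p b')"
          unfolding n_def using 3(2) n prime nz' by (intro cond_subset_div_tor) (auto simp: n_def)
        moreover have "div_tor p n (multiplicity p b') \<lesssim> (div_tor p n l :: 'a set)"
          unfolding l using U[OF 3(1)] by (rule div_tor_stable)
        moreover have "div_tor p n l \<subseteq> (div_tor p (?k - ?l) ?l :: 'a set)"
          using n by (intro div_tor_mono) (auto simp: l_def)
        moreover have "div_tor p (?k - ?l) ?l \<subseteq> (cond (p ^ ?k) b :: 'a set)"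
          by (intro div_tor_subset_cond multiplicity_dvd) auto
        moreover have "(\<Inter>(d, b)\<in>W'. cond d b) \<subseteq> (cond d' b' :: 'a set)" using W' by auto
        ultimately show ?thesis by (meson almost_mono order.trans)
      qed
    qed
    then have "(\<Inter>(d, b)\<in>W'. cond d b) \<lesssim>
        (\<Inter>p\<in>prime_factors d. cond (p ^ multiplicity p d) b :: 'a set)"
      by (intro almost_INT subgrp_cond) auto
    moreover have "(\<Inter>p\<in>prime_factors d. cond (p ^ multiplicity p d) b :: 'a set) \<subseteq> cond d b"
      using dvdg_prime_powers[OF nz(1)] by (auto simp: cond_def)
    ultimately show ?thesis by (rule almost_mono[OF _ order_refl])
  qed
  then show ?thesis using sub card by blast
qed

lemma cond_zero: "cond 0 b = {a. zs b a = 0}"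
  by (simp add: cond_def)

text \<open>Conditions with \<open>b = 0\<close> always hold, those with \<open>d = 0\<close> are
  torsion conditions, and the rest are divisibility conditions. The point is that the bound does not
  depend on \<open>W\<close>.\<close>

lemma conditions_breadth:
  fixes P :: "int set" and N :: "int \<Rightarrow> nat"
  assumes P: "finite P" "\<And>p. p \<in> P \<Longrightarrow> prime p"
    and small: "\<And>p. prime p \<Longrightarrow> p \<notin> P \<Longrightarrow> {a :: 'a::ab_group_add. zs p a = 0} \<lesssim> {0}
       \<and> (UNIV :: 'a set) \<lesssim> range (zs p)"
    and U: "\<And>p i. p \<in> P \<Longrightarrow> N p \<le> i \<Longrightarrow> (ulm_part p i :: 'a set) \<lesssim> ulm_part p (Suc i)"
    and W: "finite W"
  shows "\<exists>W'\<subseteq>W. card W' \<le> (\<Sum>p\<in>P. N p + 1) + (card P + 1) \<and>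
    (\<Inter>(d, b)\<in>W'. cond d b) \<lesssim> (\<Inter>(d, b)\<in>W. cond d b :: 'a set)"
proof -
  define W1 where "W1 = {w \<in> W. fst w \<noteq> 0 \<and> snd w \<noteq> 0}"
  define B where "B = {b. (0, b) \<in> W \<and> b \<noteq> 0}"
  have "B \<subseteq> snd ` W" by (force simp: B_def)
  then have fin: "finite W1" "finite B" "0 \<notin> B"
    using W finite_subset[of B "snd ` W"] by (simp_all add: W1_def) (simp add: B_def)
  have "\<exists>W'\<subseteq>W1. card W' \<le> (\<Sum>p\<in>P. N p + 1) \<and>
    (\<forall>(d, b)\<in>W1. (\<Inter>(d, b)\<in>W'. cond d b) \<lesssim> (cond d b :: 'a set))"
    by (rule divisibility_conditions[OF P]) (use small U fin in \<open>auto simp: W1_def\<close>)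
  then obtain W1' where W1': "W1' \<subseteq> W1" "card W1' \<le> (\<Sum>p\<in>P. N p + 1)"
    "\<And>d b. (d, b) \<in> W1 \<Longrightarrow> (\<Inter>(d, b)\<in>W1'. cond d b) \<lesssim> (cond d b :: 'a set)" by blast
  have "\<exists>B'\<subseteq>B. card B' \<le> card P + 1 \<and>
    (\<forall>b\<in>B. {a :: 'a. \<forall>b\<in>B'. zs b a = 0} \<lesssim> {a. zs b a = 0})"
    by (rule torsion_conditions[OF P]) (use small fin in auto)
  then obtain B' where B': "B' \<subseteq> B" "card B' \<le> card P + 1"
    "\<And>b. b \<in> B \<Longrightarrow> {a :: 'a. \<forall>b\<in>B'. zs b a = 0} \<lesssim> {a. zs b a = 0}" by auto
  define W' where "W' = W1' \<union> Pair 0 ` B'"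
  have sub: "W' \<subseteq> W" using W1'(1) B'(1) by (auto simp: W'_def W1_def B_def)
  have "card W' \<le> card W1' + card (Pair (0 :: int) ` B')"
    unfolding W'_def by (rule card_Un_le)
  also have "card (Pair (0 :: int) ` B') = card B'"
    by (rule card_image) (simp add: inj_on_def)
  finally have card: "card W' \<le> (\<Sum>p\<in>P. N p + 1) + (card P + 1)"
    using W1'(2) B'(2) by simp
  have le: "(\<Inter>(d, b)\<in>W'. cond d b) \<lesssim> (cond d b :: 'a set)" if db: "(d, b) \<in> W" for d b
  proof -
    consider "b = 0" | "(d, b) \<in> W1" | "d = 0" "b \<in> B"
      using db by (auto simp: W1_def B_def)
    then show ?thesis
    proof cases
      case 1
      then show ?thesis by (intro almost_subset) (auto simp: cond_def)
    next
      case 2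
      show ?thesis by (rule almost_mono[OF W1'(3)[OF 2] _ order_refl]) (auto simp: W'_def)
    next
      case 3
      have "a \<in> cond 0 b" if "a \<in> (\<Inter>(d, b)\<in>W'. cond d b)" "b \<in> B'" for a :: 'a and b
        using INT_D[OF that(1), of "(0, b)"] that(2) by (simp add: W'_def)
      then have "(\<Inter>(d, b)\<in>W'. cond d b) \<subseteq> {a :: 'a. \<forall>b\<in>B'. zs b a = 0}"
        unfolding cond_zero by blast
      then show ?thesis
        unfolding 3(1) cond_zero by (rule almost_mono[OF B'(3)[OF 3(2)] _ order_refl])
    qed
  qed
  have "(\<Inter>(d, b)\<in>W'. cond d b) \<lesssim> (\<Inter>w\<in>W. (case w of (d, b) \<Rightarrow> cond d b) :: 'a set)"
    using W le by (intro almost_INT) (auto simp: subgrp_cond)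
  then show ?thesis using sub card by blast
qed

section \<open>Condition (4) bounds irredundant families in a one-dimensional fibre\<close>

lemma zs_int_fun: "zs (int n) = nsmul n"
  by (simp add: fun_eq_iff zs_int)

lemma torsion_part_eq_ulm_part:
  "torsion_part p (range (nsmul (p ^ i))) = (ulm_part (int p) i :: 'a::ab_group_add set)"
  by (auto simp: torsion_part_def ulm_part_def dvdg_def zs_int simp flip: of_nat_power)

text \<open>Along a coordinate axis every member of \<open>I\<close> becomes a finite intersection
  of groups \<open>cond d b\<close>. At most \<open>D\<close> of all these conditions matter up to
  finite index, each comes from some member of \<open>I\<close>, and an irredundant \<open>I\<close>
  has no further members.\<close>

lemma fibre_breadth:
  assumes sing: "finite {p. singular_prime TYPE('a::ab_group_add) p}"
    and ulm: "\<forall>p. prime p \<longrightarrow> finite (U_infinite TYPE('a) p)"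
  shows "\<exists>D. \<forall>v I. finite I \<longrightarrow> (\<forall>H\<in>I. pp H) \<longrightarrow>
    irredundant (supp {v} :: (nat \<Rightarrow> 'a) set) I (\<lambda>H. H) \<longrightarrow> card I \<le> D"
proof -
  define P where "P = int ` {p. singular_prime TYPE('a) p}"
  have P: "finite P" "\<And>p. p \<in> P \<Longrightarrow> prime p"
    using sing by (auto simp: P_def singular_prime_def)
  have small: "{a :: 'a. zs p a = 0} \<lesssim> {0} \<and> (UNIV :: 'a set) \<lesssim> range (zs p)"
    if p: "prime p" "p \<notin> P" for p
  proof -
    obtain q where q: "p = int q" using prime_ge_0_int[OF p(1)] nonneg_int_cases by blast
    then have "\<not> singular_prime TYPE('a) q" "prime q" using p by (auto simp: P_def)
    then have fin: "finite (torsion_part q (UNIV :: 'a set))"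
      "finite (cosets (UNIV :: 'a set) (range (nsmul q)))"
      by (auto simp: singular_prime_def)
    have "subgrp (range (zs p) :: 'a set)"
      by (auto simp: subgrp_def image_iff simp flip: zs.scale_right_diff_distrib intro: exI[of _ 0])
    then show ?thesis
      using fin finite_cosetsD[OF fin(2)]
      by (auto simp: q zs_int_fun torsion_part_def intro!: almost_finite)
  qed
  have "\<exists>N. \<forall>i\<ge>N. (ulm_part p i :: 'a set) \<lesssim> ulm_part p (Suc i)" if p: "p \<in> P" for p
  proof -
    obtain q where q: "p = int q" "prime q"
      using p by (auto simp: P_def singular_prime_def)
    obtain N where N: "\<And>i. i \<in> U_infinite TYPE('a) q \<Longrightarrow> i < N"
      using ulm[rule_format, OF q(2)] unfolding finite_nat_set_iff_bounded by auto
    have "(ulm_part p i :: 'a set) \<lesssim> ulm_part p (Suc i)" if "i \<ge> N" for i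
    proof (rule finite_cosetsD[OF _ subgrp_ulm_part])
      have "i \<notin> U_infinite TYPE('a) q" using N that by fastforce
      then show "finite (cosets (ulm_part p i :: 'a set) (ulm_part p (Suc i)))"
        by (simp only: U_infinite_def mem_Collect_eq not_not torsion_part_eq_ulm_part q(1) Suc_eq_plus1)
    qed
    then show ?thesis by blast
  qed
  then obtain N where N: "\<And>p i. p \<in> P \<Longrightarrow> N p \<le> i \<Longrightarrow> (ulm_part p i :: 'a set) \<lesssim> ulm_part p (Suc i)"
    by metis
  define D where "D = (\<Sum>p\<in>P. N p + 1) + (card P + 1)"
  have "card I \<le> D" if I: "finite I" "\<forall>H\<in>I. pp H" "irredundant (supp {v} :: (nat \<Rightarrow> 'a) set) I (\<lambda>H. H)"
    for v I
  proof -
    define \<iota> where "\<iota> a = (0 :: nat \<Rightarrow> 'a)(v := a)" for a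
    have supp: "supp {v} = range \<iota>"
    proof (intro subset_antisym subsetI)
      fix e :: "nat \<Rightarrow> 'a" assume "e \<in> supp {v}"
      then have "e = \<iota> (e v)" by (auto simp: supp_def \<iota>_def)
      then show "e \<in> range \<iota>" by blast
    qed (auto simp: supp_def \<iota>_def)
    have "\<exists>W. finite W \<and> (\<forall>a. \<iota> a \<in> H \<longleftrightarrow> a \<in> (\<Inter>(d, b)\<in>W. cond d b))" if "H \<in> I" for H
    proof -
      have "pp H" using I(2) that by (rule bspec)
      then obtain W where W: "finite W" "\<forall>(d, f)\<in>W. linear_form f" "H = pp_set W"
        unfolding pp_def by (elim exE conjE)
      have "\<exists>c. \<forall>a. f (\<iota> a) = zs c a" if f: "linear_form f" for f
      proof -
        obtain c g where g: "linear_form g" "\<And>e a. f (e(v := a)) = g e + zs c a"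
          using linear_form_split[OF f] by blast
        then show ?thesis using linear_form_eval_0[OF g(1)] by (auto simp: \<iota>_def)
      qed
      then have "\<forall>f. \<exists>c. linear_form f \<longrightarrow> (\<forall>a. f (\<iota> a) = zs c a)" by blast
      from choice[OF this] obtain c
        where c: "\<And>f a. linear_form f \<Longrightarrow> f (\<iota> a) = zs (c f) a" by auto
      have "\<iota> a \<in> H \<longleftrightarrow> a \<in> (\<Inter>(d, b)\<in>(\<lambda>(d, f). (d, c f)) ` W. cond d b)" for a
      proof -
        have "\<iota> a \<in> H \<longleftrightarrow> (\<forall>w\<in>W. dvdg (fst w) (snd w (\<iota> a)))"
          by (simp add: W(3) pp_set_def dvdg_def case_prod_beta)
        also have "\<dots> \<longleftrightarrow> (\<forall>w\<in>W. dvdg (fst w) (zs (c (snd w)) a))"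
          using W(2) c by (intro ball_cong refl) auto
        also have "\<dots> \<longleftrightarrow> a \<in> (\<Inter>(d, b)\<in>(\<lambda>(d, f). (d, c f)) ` W. cond d b)"
          by (simp add: cond_def case_prod_beta)
        finally show ?thesis .
      qed
      then show ?thesis
        using W(1) by (intro exI[of _ "(\<lambda>(d, f). (d, c f)) ` W"]) simp
    qed
    then obtain W where W: "\<And>H. H \<in> I \<Longrightarrow> finite (W H)"
      "\<And>H a. H \<in> I \<Longrightarrow> \<iota> a \<in> H \<longleftrightarrow> a \<in> (\<Inter>(d, b)\<in>W H. cond d b)" by metis
    have "\<exists>W'\<subseteq>(\<Union>H\<in>I. W H). card W' \<le> D \<and>
      (\<Inter>(d, b)\<in>W'. cond d b) \<lesssim> (\<Inter>(d, b)\<in>(\<Union>H\<in>I. W H). cond d b :: 'a set)"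
      unfolding D_def by (rule conditions_breadth[OF P small N]) (use I(1) W(1) in auto)
    then obtain W' where W': "W' \<subseteq> (\<Union>H\<in>I. W H)" "card W' \<le> D"
      "(\<Inter>(d, b)\<in>W'. cond d b) \<lesssim> (\<Inter>(d, b)\<in>(\<Union>H\<in>I. W H). cond d b :: 'a set)" by blast
    have "finite W'" using W'(1) I(1) W(1) by (meson finite_UN_I finite_subset)
    have "\<forall>w\<in>W'. \<exists>H\<in>I. w \<in> W H" using W'(1) by blast
    then obtain h where h: "\<And>w. w \<in> W' \<Longrightarrow> h w \<in> I \<and> w \<in> W (h w)" by metis
    \<comment> \<open>One member of \<open>I\<close> for each retained condition.\<close>
    define J where "J = h ` W'"
    have J: "J \<subseteq> I" "card J \<le> D"
      using h card_image_le[OF \<open>finite W'\<close>, of h] W'(2) by (auto simp: J_def)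
    have "I \<subseteq> J"
    proof (rule ccontr)
      assume "\<not> I \<subseteq> J"
      then obtain i where i: "i \<in> I" "i \<notin> J" by blast
      have "\<iota> ` (\<Inter>(d, b)\<in>W'. cond d b) \<lesssim> \<iota> ` (\<Inter>(d, b)\<in>(\<Union>H\<in>I. W H). cond d b)"
        by (rule almost_image[OF W'(3)]) (auto simp: \<iota>_def)
      moreover have "supp {v} \<inter> (\<Inter>j\<in>I - {i}. j) \<subseteq> \<iota> ` (\<Inter>(d, b)\<in>W'. cond d b)"
      proof
        fix e assume e: "e \<in> supp {v} \<inter> (\<Inter>j\<in>I - {i}. j)"
        then obtain a where a: "e = \<iota> a" unfolding supp by blast
        have "a \<in> cond d b" if "(d, b) \<in> W'" for d b
        proof -
          have "h (d, b) \<in> I - {i}" using h[OF that] that i by (auto simp: J_def)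
          then have "\<iota> a \<in> h (d, b)" using e a by auto
          then show ?thesis using h[OF that] W(2) by fast
        qed
        then show "e \<in> \<iota> ` (\<Inter>(d, b)\<in>W'. cond d b)" using a by blast
      qed
      moreover have "\<iota> ` (\<Inter>(d, b)\<in>(\<Union>H\<in>I. W H). cond d b) \<subseteq> supp {v} \<inter> (\<Inter>j\<in>I. j)"
      proof
        fix e assume "e \<in> \<iota> ` (\<Inter>(d, b)\<in>(\<Union>H\<in>I. W H). cond d b)"
        then obtain a where a: "e = \<iota> a" "a \<in> (\<Inter>(d, b)\<in>(\<Union>H\<in>I. W H). cond d b)" by blast
        then have "e \<in> H" if "H \<in> I" for H using W(2)[OF that, of a] that by blast
        then show "e \<in> supp {v} \<inter> (\<Inter>j\<in>I. j)" using a(1) supp by blast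
      qed
      ultimately have "supp {v} \<inter> (\<Inter>j\<in>I - {i}. j) \<lesssim> supp {v} \<inter> (\<Inter>j\<in>I. j)"
        by (rule almost_mono)
      then show False using I(3) i(1) by (simp add: irredundant_def)
    qed
    then have "I = J" using J(1) by (rule subset_antisym)
    then show ?thesis using J(2) by simp
  qed
  then show ?thesis by blast
qed


subsection \<open>Lower bounds for the VC density\<close>

primrec trm_mult :: "nat \<Rightarrow> trm \<Rightarrow> trm" where
  "trm_mult 0 t = Zero"
| "trm_mult (Suc n) t = Plus (trm_mult n t) t"

lemma trm_val_trm_mult [simp]: "trm_val e (trm_mult n t) = zs (int n) (trm_val e t)"
  unfolding zs_int by (induction n) simp_all

lemma trm_vars_trm_mult: "trm_vars (trm_mult n t) \<subseteq> trm_vars t"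
  by (induction n) auto

definition conj_list :: "fm list \<Rightarrow> fm" where
  "conj_list \<phi>s = foldr Conj \<phi>s (Eq Zero Zero)"

lemma sat_conj_list: "sat e (conj_list \<phi>s) \<longleftrightarrow> (\<forall>\<phi>\<in>set \<phi>s. sat e \<phi>)"
  by (induction \<phi>s) (simp_all add: conj_list_def)

lemma free_vars_conj_list: "free_vars (conj_list \<phi>s) = (\<Union>\<phi>\<in>set \<phi>s. free_vars \<phi>)"
  by (induction \<phi>s) (simp_all add: conj_list_def)

text \<open>The variables \<open>1, \<dots>, D\<close> select one of \<open>D\<close> conditions on the difference of the variables
  \<open>0\<close> and \<open>D + 1\<close>.\<close>

definition selector_fm :: "nat \<Rightarrow> (nat \<Rightarrow> nat) \<Rightarrow> (nat \<Rightarrow> nat) \<Rightarrow> fm" where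
  "selector_fm D d b = Neg (conj_list (map (\<lambda>s. Neg (Conj (Neg (Eq (Var (Suc s)) Zero))
     (Ex (D + 2) (Eq (Plus (trm_mult (d s) (Var (D + 2))) (trm_mult (b s) (Var 0)))
       (trm_mult (b s) (Var (D + 1))))))) [0..<D]))"

lemma partitioned_selector_fm: "partitioned (selector_fm D d b) (D + 1) 1"
  using trm_vars_trm_mult[of _ "Var 0"] trm_vars_trm_mult[of _ "Var (D + 1)"]
    trm_vars_trm_mult[of _ "Var (D + 2)"]
  by (fastforce simp: partitioned_def selector_fm_def free_vars_conj_list)

lemma sat_selector_fm:
  "sat e (selector_fm D d b) \<longleftrightarrow>
    (\<exists>s<D. e (Suc s) \<noteq> 0 \<and> dvdg (int (d s)) (zs (int (b s)) (e (D + 1) - e 0)))"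
proof -
  have "(\<exists>a. zs n a + x = y) \<longleftrightarrow> dvdg n (y - x)" for n and x y :: 'a
    by (auto simp: dvdg_def eq_diff_eq)
  then show ?thesis
    by (auto simp: selector_fm_def sat_conj_list zs.scale_right_diff_distrib)
qed

lemma shatter_fun_ge:
  fixes S :: "'a::ab_group_add list set"
  assumes "S \<subseteq> tuples k" "finite S" "card S = t"
  shows "card ((\<lambda>b. S \<inter> def_set \<phi> k b) ` tuples n) \<le> shatter_fun TYPE('a) \<phi> k n t"
proof -
  have "card ((\<lambda>b. S \<inter> def_set \<phi> k b) ` tuples n) \<le> 2 ^ t"
    if "finite S" "card S = t" for S :: "'a list set"
  proof -
    have "card ((\<lambda>b. S \<inter> def_set \<phi> k b) ` tuples n) \<le> card (Pow S)"
      using that by (intro card_mono) auto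
    then show ?thesis using that by (simp add: card_Pow)
  qed
  then have "bdd_above ((\<lambda>S :: 'a list set. card ((\<lambda>b. S \<inter> def_set \<phi> k b) ` tuples n)) `
      {S. S \<subseteq> tuples k \<and> finite S \<and> card S = t})"
    by (intro bdd_aboveI2[where M = "2 ^ t"]) auto
  then show ?thesis unfolding shatter_fun_def using assms by (intro cSUP_upper) auto
qed

text \<open>Along the arguments \<open>D * T\<close> a bound of order \<open>t^r\<close> gives one
  of order \<open>T^r\<close>, as the constant \<open>D^r\<close> is absorbed; comparison with
  \<open>T^D\<close> yields \<open>D \<le> r\<close>.\<close>

lemma vc_density_ge:
  assumes "D > 0" "\<And>T. T ^ D \<le> shatter_fun TYPE('a::ab_group_add) \<phi> k n (D * T)"
  shows "ereal (real D) \<le> vc_density TYPE('a) \<phi> k n"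
  unfolding vc_density_def
proof (rule INF_greatest, clarify)
  let ?f = "\<lambda>t. real (shatter_fun TYPE('a) \<phi> k n t)"
  fix r :: real assume r: "0 \<le> r" "?f \<in> O(\<lambda>t. real t powr r)"
  have lim: "filterlim (\<lambda>T. D * T) sequentially sequentially"
    using assms(1) by (simp add: filterlim_subseq strict_mono_def)
  have "(\<lambda>T. real T powr real D) \<in> O(\<lambda>T. ?f (D * T))"
  proof (rule landau_o.big_mono, intro eventually_mono[OF eventually_gt_at_top[of 0]])
    fix T :: nat assume "T > 0"
    then have "real T powr real D = real (T ^ D)" by (simp add: powr_realpow)
    also have "\<dots> \<le> ?f (D * T)" using assms(2) by (simp only: of_nat_le_iff)
    finally show "norm (real T powr real D) \<le> norm (?f (D * T))" by simp
  qed
  also have "(\<lambda>T. ?f (D * T)) \<in> O(\<lambda>T. real (D * T) powr r)"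
    using landau_o.big.compose[OF r(2) lim] by simp
  also have "(\<lambda>T. real (D * T) powr r) \<in> O(\<lambda>T. real T powr r)"
    by (intro bigoI[of _ "real D powr r"]) (simp add: powr_mult)
  finally have "real D \<le> r"
    using powr_bigo_iff[of real sequentially "real D" r] filterlim_real_sequentially by simp
  then show "ereal (real D) \<le> ereal r" by simp
qed

text \<open>For each function \<open>f\<close> the sum of the elements \<open>c s (f s)\<close>
  agrees with \<open>c s (f s)\<close> modulo the condition \<open>s\<close>. Hence
  \<open>D * T\<close> points have at least \<open>T^D\<close> traces.\<close>

lemma vc_fun_1_ge:
  fixes d b :: "nat \<Rightarrow> nat" and c :: "nat \<Rightarrow> nat \<Rightarrow> 'a::ab_group_add"
  assumes nontriv: "(a1 :: 'a) \<noteq> 0"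
    and distinct: "\<And>s r r'. s < D \<Longrightarrow> r \<noteq> r' \<Longrightarrow> \<not> dvdg (int (d s)) (zs (int (b s)) (c s r - c s r'))"
    and other: "\<And>s s' r. s < D \<Longrightarrow> s' < D \<Longrightarrow> s \<noteq> s' \<Longrightarrow> dvdg (int (d s')) (zs (int (b s')) (c s r))"
  shows "ereal (real D) \<le> vc_fun TYPE('a) 1"
proof (cases "D = 0")
  case True
  have "ereal (real D) \<le> vc_density TYPE('a) (Eq Zero Zero) 0 1"
    unfolding vc_density_def True by (rule INF_greatest) auto
  also have "\<dots> \<le> vc_fun TYPE('a) 1"
    unfolding vc_fun_def by (rule SUP_upper2[of "(Eq Zero Zero, 0)"]) (auto simp: partitioned_def)
  finally show ?thesis .
next
  case False
  define \<phi> where "\<phi> = selector_fm D d b"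
  \<comment> \<open>The first coordinate is the representative \<open>c s r\<close>; the other
    \<open>D\<close> coordinates select condition \<open>s\<close> by a nonzero entry.\<close>
  define pt where "pt = (\<lambda>(s, r). c s r # map (\<lambda>j. if j = s then a1 else 0) [0..<D])"
  have pt_len: "pt x \<in> tuples (D + 1)" for x
    by (simp add: pt_def tuples_def case_prod_beta)
  have inj: "inj_on pt ({..<D} \<times> UNIV)"
  proof (rule inj_onI, clarify)
    fix s r s' r' assume s: "s < D" "s' < D" and eq: "pt (s, r) = pt (s', r')"
    have "pt (s, r) ! Suc s = pt (s', r') ! Suc s" using eq by simp
    then have "s = s'" using s nontriv by (auto simp: pt_def split: if_splits)
    moreover have "r = r'"
      using distinct[OF s(1), of r r'] eq \<open>s = s'\<close> by (auto simp: pt_def)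
    ultimately show "s = s' \<and> r = r'" by simp
  qed
  have mem: "pt (s, r) \<in> def_set \<phi> (D + 1) [y] \<longleftrightarrow> dvdg (int (d s)) (zs (int (b s)) (y - c s r))"
    if s: "s < D" for s r y
  proof -
    have "(pt (s, r) @ [y]) ! 0 = c s r" "(pt (s, r) @ [y]) ! (D + 1) = y"
      "\<And>s'. s' < D \<Longrightarrow> (pt (s, r) @ [y]) ! Suc s' = (if s' = s then a1 else 0)"
      by (auto simp: pt_def nth_append)
    then have "sat ((!) (pt (s, r) @ [y])) \<phi> \<longleftrightarrow>
        (\<exists>s'<D. (if s' = s then a1 else 0) \<noteq> 0 \<and> dvdg (int (d s')) (zs (int (b s')) (y - c s r)))"
      unfolding \<phi>_def sat_selector_fm by (metis (no_types, lifting))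
    then show ?thesis using s nontriv pt_len[of "(s, r)"] by (auto simp: def_set_def)
  qed
  have "T ^ D \<le> shatter_fun TYPE('a) \<phi> (D + 1) 1 (D * T)" for T
  proof -
    define S where "S = pt ` ({..<D} \<times> {..<T})"
    have S: "S \<subseteq> tuples (D + 1)" "finite S" "card S = D * T"
      using pt_len card_image[OF inj_on_subset[OF inj, of "{..<D} \<times> {..<T}"]]
      by (auto simp: S_def card_cartesian_product)
    define y where "y f = (\<Sum>s<D. c s (f s))" for f
    have trace: "pt (s, r) \<in> def_set \<phi> (D + 1) [y f] \<longleftrightarrow> r = f s" if s: "s < D" for s r f
    proof -
      have "y f = c s (f s) + (\<Sum>s'\<in>{..<D} - {s}. c s' (f s'))"
        unfolding y_def using s by (simp add: sum.remove)
      then have split: "zs (int (b s)) (y f - c s r) = zs (int (b s)) (c s (f s) - c s r) +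
          (\<Sum>s'\<in>{..<D} - {s}. zs (int (b s)) (c s' (f s')))"
        by (simp add: zs.scale_right_distrib zs.scale_right_diff_distrib zs.scale_sum_right)
      have rest: "dvdg (int (d s)) (\<Sum>s'\<in>{..<D} - {s}. zs (int (b s)) (c s' (f s')))"
        using other[OF _ s] by (intro dvdg_sum) auto
      have "dvdg (int (d s)) (zs (int (b s)) (y f - c s r)) \<longleftrightarrow>
          dvdg (int (d s)) (zs (int (b s)) (c s (f s) - c s r))"
        unfolding split using rest by (rule dvdg_add_iff)
      then show ?thesis unfolding mem[OF s] using distinct[OF s, of "f s" r] by auto
    qed
    have "inj_on (\<lambda>f. S \<inter> def_set \<phi> (D + 1) [y f]) ({..<D} \<rightarrow>\<^sub>E {..<T})"
    proof (rule inj_onI)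
      fix f g assume f: "f \<in> {..<D} \<rightarrow>\<^sub>E {..<T}" and g: "g \<in> {..<D} \<rightarrow>\<^sub>E {..<T}"
        and eq: "S \<inter> def_set \<phi> (D + 1) [y f] = S \<inter> def_set \<phi> (D + 1) [y g]"
      show "f = g"
      proof (rule PiE_ext[OF f g])
        fix s assume "s \<in> {..<D}"
        then have s: "s < D" "f s < T" using f by auto
        then have "pt (s, f s) \<in> S" by (auto simp: S_def)
        then have "pt (s, f s) \<in> def_set \<phi> (D + 1) [y g]"
          using eq trace[OF s(1), of "f s" f] by blast
        then show "f s = g s" using trace[OF s(1)] by simp
      qed
    qed
    then have "card ((\<lambda>f. S \<inter> def_set \<phi> (D + 1) [y f]) ` ({..<D} \<rightarrow>\<^sub>E {..<T})) = T ^ D"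
      by (simp add: card_image card_PiE)
    moreover have "(\<lambda>f. S \<inter> def_set \<phi> (D + 1) [y f]) ` ({..<D} \<rightarrow>\<^sub>E {..<T}) \<subseteq>
        (\<lambda>b. S \<inter> def_set \<phi> (D + 1) b) ` tuples 1"
      by (auto simp: tuples_def)
    moreover have "finite ((\<lambda>b. S \<inter> def_set \<phi> (D + 1) b) ` tuples 1)"
      by (rule finite_subset[of _ "Pow S"]) (use S(2) in auto)
    ultimately have "T ^ D \<le> card ((\<lambda>b. S \<inter> def_set \<phi> (D + 1) b) ` tuples 1)"
      by (metis card_mono)
    also have "\<dots> \<le> shatter_fun TYPE('a) \<phi> (D + 1) 1 (D * T)"
      by (rule shatter_fun_ge[OF S])
    finally show ?thesis .
  qed
  then have "ereal (real D) \<le> vc_density TYPE('a) \<phi> (D + 1) 1"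
    using False by (intro vc_density_ge) auto
  also have "\<dots> \<le> vc_fun TYPE('a) 1"
    unfolding vc_fun_def
    by (rule SUP_upper2[of "(\<phi>, D + 1)"]) (use partitioned_selector_fm[of D d b] in \<open>auto simp: \<phi>_def\<close>)
  finally show ?thesis .
qed

section \<open>Long independent families from each failure of condition (4)\<close>

lemma coprime_prod_other_primes:
  assumes "inj_on p {..<D}" "\<And>s. s < D \<Longrightarrow> prime (p s :: nat)" "s < D"
  shows "coprime (int (p s)) (int (\<Prod>s'\<in>{..<D} - {s}. p s'))"
proof -
  have "coprime (p s) (\<Prod>s'\<in>{..<D} - {s}. p s')"
    using assms by (intro prod_coprime_right primes_coprime) (auto simp: inj_on_def)
  then show ?thesis by (simp only: coprime_int_iff)
qed

text \<open>The conditions are divisibility by distinct primes. Multiplying representatives modulo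
  \<open>p s\<close> by the product of the other primes satisfies the other conditions and, by
  coprimality, keeps the representatives apart modulo \<open>p s\<close>.\<close>

lemma vc_fun_1_ge_of_quotients:
  assumes "(a1 :: 'a::ab_group_add) \<noteq> 0"
    and inf: "infinite {p. prime p \<and> infinite (cosets (UNIV :: 'a set) (range (nsmul p)))}"
  shows "ereal (real D) \<le> vc_fun TYPE('a) 1"
proof -
  define p where "p = enumerate {p. prime p \<and> infinite (cosets (UNIV :: 'a set) (range (nsmul p)))}"
  have p: "prime (p s)" "infinite (cosets (UNIV :: 'a set) (range (nsmul (p s))))" for s
    using enumerate_in_set[OF inf, of s] by (auto simp: p_def)
  have inj: "inj_on p {..<D}"
    unfolding p_def using strict_mono_enumerate[OF inf] strict_mono_imp_inj_on inj_on_subset by blast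
  have "\<exists>c :: nat \<Rightarrow> 'a. \<forall>r r'. r \<noteq> r' \<longrightarrow> \<not> dvdg (int (p s)) (c r - c r')" for s
  proof -
    have sub: "subgrp (range (nsmul (p s)) :: 'a set)"
      by (auto simp: subgrp_def image_iff simp flip: zs_int zs.scale_right_diff_distrib intro: exI[of _ 0])
    obtain c :: "nat \<Rightarrow> 'a" where "\<And>r r'. r \<noteq> r' \<Longrightarrow> c r - c r' \<notin> range (nsmul (p s))"
      using infinite_cosetsD[OF p(2) sub] by metis
    then have "\<not> dvdg (int (p s)) (c r - c r')" if "r \<noteq> r'" for r r'
      using that unfolding dvdg_def zs_int by (metis rangeI)
    then show ?thesis by blast
  qed
  then obtain a :: "nat \<Rightarrow> nat \<Rightarrow> 'a" where a: "\<And>s r r'. r \<noteq> r' \<Longrightarrow> \<not> dvdg (int (p s)) (a s r - a s r')"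
    by metis
  define q where "q s = (\<Prod>s'\<in>{..<D} - {s}. p s')" for s
  show ?thesis
  proof (rule vc_fun_1_ge[OF assms(1), where d = p and b = "\<lambda>s. 1" and c = "\<lambda>s r. zs (int (q s)) (a s r)"])
    fix s r r' :: nat assume s: "s < D" "r \<noteq> r'"
    have "coprime (int (p s)) (int (q s))"
      unfolding q_def using inj p s by (intro coprime_prod_other_primes) auto
    then show "\<not> dvdg (int (p s)) (zs (int 1) (zs (int (q s)) (a s r) - zs (int (q s)) (a s r')))"
      using a[OF s(2), of s] by (auto simp flip: zs.scale_right_diff_distrib dest: dvdg_zs_cancel)
  next
    fix s s' r assume s: "s < D" "s' < D" "s \<noteq> s'"
    then have "p s' dvd q s" unfolding q_def by (intro dvd_prodI) auto
    then show "dvdg (int (p s')) (zs (int 1) (zs (int (q s)) (a s r)))"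
      by (simp add: dvdg_zs_dvd)
  qed
qed

text \<open>The condition for \<open>s\<close> is annihilation by the product \<open>q s\<close> of
  the other primes. This product kills the torsion at those primes, while by Bezout it is injective
  on the torsion at \<open>p s\<close>.\<close>

lemma vc_fun_1_ge_of_torsion:
  assumes "(a1 :: 'a::ab_group_add) \<noteq> 0"
    and inf: "infinite {p. prime p \<and> infinite (torsion_part p (UNIV :: 'a set))}"
  shows "ereal (real D) \<le> vc_fun TYPE('a) 1"
proof -
  define p where "p = enumerate {p. prime p \<and> infinite (torsion_part p (UNIV :: 'a set))}"
  have p: "prime (p s)" "infinite (torsion_part (p s) (UNIV :: 'a set))" for s
    using enumerate_in_set[OF inf, of s] by (auto simp: p_def)
  have inj: "inj_on p {..<D}"
    unfolding p_def using strict_mono_enumerate[OF inf] strict_mono_imp_inj_on inj_on_subset by blast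
  have "\<exists>c :: nat \<Rightarrow> 'a. inj c \<and> (\<forall>r. zs (int (p s)) (c r) = 0)" for s
    using infinite_countable_subset[OF p(2)[of s]] by (auto simp: torsion_part_def zs_int)
  then obtain c :: "nat \<Rightarrow> nat \<Rightarrow> 'a" where c: "\<And>s. inj (c s)" "\<And>s r. zs (int (p s)) (c s r) = 0"
    by metis
  define q where "q s = (\<Prod>s'\<in>{..<D} - {s}. p s')" for s
  show ?thesis
  proof (rule vc_fun_1_ge[OF assms(1), where d = "\<lambda>s. 0" and b = q and c = c])
    fix s r r' :: nat assume s: "s < D" "r \<noteq> r'"
    have cop: "coprime (int (p s)) (int (q s))"
      unfolding q_def using inj p s by (intro coprime_prod_other_primes) auto
    obtain u v where uv: "\<And>a :: 'a. a = zs (u * int (p s)) a + zs (v * int (q s)) a"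
      using bezout_zs[OF cop] by blast
    show "\<not> dvdg (int 0) (zs (int (q s)) (c s r - c s r'))"
    proof
      assume "dvdg (int 0) (zs (int (q s)) (c s r - c s r'))"
      moreover have "zs (int (p s)) (c s r - c s r') = 0"
        using c(2) by (simp add: zs.scale_right_diff_distrib)
      ultimately have "c s r - c s r' = 0"
        using uv[of "c s r - c s r'"] by (simp flip: zs.scale_scale)
      then show False using c(1)[of s] s(2) by (simp add: inj_eq)
    qed
  next
    fix s s' r assume s: "s < D" "s' < D" "s \<noteq> s'"
    then have "p s dvd q s'" unfolding q_def by (intro dvd_prodI) auto
    then obtain n where "q s' = n * p s" by (metis dvd_div_mult_self)
    then show "dvdg (int 0) (zs (int (q s')) (c s r))"
      using c(2)[of s r] by (simp flip: zs.scale_scale)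
  qed
qed

lemma enumerate_add_le:
  assumes "infinite (S :: nat set)"
  shows "enumerate S n + m \<le> enumerate S (n + m)"
proof (induction m)
  case (Suc m)
  then show ?case using enumerate_step[OF assms, of "n + m"] by simp
qed simp

text \<open>Representatives of the infinite Ulm quotient at \<open>i s\<close> have the form
  \<open>p^(i s) x\<close>. The elements \<open>p^s x\<close> and the conditions that
  \<open>p^(i s + 1)\<close> divides \<open>p^(i s - s) y\<close> are independent: smaller indices
  give conditions that hold by divisibility, larger ones conditions that hold because the multiple
  of \<open>x\<close> vanishes.\<close>

lemma vc_fun_1_ge_of_ulm:
  assumes "(a1 :: 'a::ab_group_add) \<noteq> 0" and inf: "infinite (U_infinite TYPE('a) p)"
  shows "ereal (real D) \<le> vc_fun TYPE('a) 1"
proof -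
  \<comment> \<open>Taking every second element makes \<open>i s - s\<close> strictly increasing, as
    needed for the multiples to vanish at larger indices.\<close>
  define i where "i s = enumerate (U_infinite TYPE('a) p) (2 * s)" for s
  have i_ge: "s \<le> i s" for s
    using le_enumerate[OF inf, of "2 * s"] by (simp add: i_def)
  have i_gap: "i s + 2 * (s' - s) \<le> i s'" if "s \<le> s'" for s s'
    using enumerate_add_le[OF inf, of "2 * s" "2 * (s' - s)"] that by (simp add: i_def algebra_simps)
  have "\<exists>x :: nat \<Rightarrow> 'a. (\<forall>r. zs (int (p ^ (i s + 1))) (x r) = 0) \<and>
      (\<forall>r r'. r \<noteq> r' \<longrightarrow> \<not> dvdg (int (p ^ (i s + 1))) (zs (int (p ^ i s)) (x r - x r')))" for s
  proof -
    have "i s \<in> U_infinite TYPE('a) p"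
      unfolding i_def by (rule enumerate_in_set[OF inf])
    then have "infinite (cosets (ulm_part (int p) (i s) :: 'a set) (ulm_part (int p) (i s + 1)))"
      by (simp only: U_infinite_def mem_Collect_eq torsion_part_eq_ulm_part) simp
    then obtain c :: "nat \<Rightarrow> 'a" where c: "\<And>r. c r \<in> ulm_part (int p) (i s)"
      "\<And>r r'. r \<noteq> r' \<Longrightarrow> c r - c r' \<notin> ulm_part (int p) (i s + 1)"
      using infinite_cosetsD[OF _ subgrp_ulm_part] by metis
    then have "\<forall>r. \<exists>x. zs (int (p ^ i s)) x = c r" by (auto simp: ulm_part_def dvdg_def)
    then obtain x where x: "\<And>r. zs (int (p ^ i s)) (x r) = c r" by metis
    have pc: "zs (int p) (c r) = 0" for r using c(1) by (auto simp: ulm_part_def)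
    have "zs (int (p ^ (i s + 1))) (x r) = zs (int p) (zs (int (p ^ i s)) (x r))" for r
      by (simp add: mult.commute)
    then have "zs (int (p ^ (i s + 1))) (x r) = 0" for r by (simp only: x pc)
    moreover have "\<not> dvdg (int (p ^ (i s + 1))) (zs (int (p ^ i s)) (x r - x r'))" if "r \<noteq> r'" for r r'
      using c(2)[OF that] pc x by (auto simp: ulm_part_def zs.scale_right_diff_distrib)
    ultimately show ?thesis by blast
  qed
  then obtain x :: "nat \<Rightarrow> nat \<Rightarrow> 'a"
    where x: "\<And>s r. zs (int (p ^ (i s + 1))) (x s r) = 0"
      "\<And>s r r'. r \<noteq> r' \<Longrightarrow> \<not> dvdg (int (p ^ (i s + 1))) (zs (int (p ^ i s)) (x s r - x s r'))"
    by metis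
  show ?thesis
  proof (rule vc_fun_1_ge[OF assms(1), where d = "\<lambda>s. p ^ (i s + 1)" and b = "\<lambda>s. p ^ (i s - s)"
        and c = "\<lambda>s r. zs (int (p ^ s)) (x s r)"])
    fix s r r' :: nat assume "r \<noteq> r'"
    have "zs (int (p ^ (i s - s))) (zs (int (p ^ s)) (x s r) - zs (int (p ^ s)) (x s r')) =
        zs (int (p ^ i s)) (x s r - x s r')"
      using i_ge[of s] by (simp flip: zs.scale_right_diff_distrib power_add)
    then show "\<not> dvdg (int (p ^ (i s + 1)))
        (zs (int (p ^ (i s - s))) (zs (int (p ^ s)) (x s r) - zs (int (p ^ s)) (x s r')))"
      using x(2)[OF \<open>r \<noteq> r'\<close>] by simp
  next
    fix s s' r :: nat assume "s \<noteq> s'"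
    have eq: "zs (int (p ^ (i s' - s'))) (zs (int (p ^ s)) (x s r)) = zs (int (p ^ (i s' - s' + s))) (x s r)"
      by (simp add: power_add)
    show "dvdg (int (p ^ (i s' + 1))) (zs (int (p ^ (i s' - s'))) (zs (int (p ^ s)) (x s r)))"
    proof (cases "s' < s")
      case True
      then have "i s' + 1 \<le> i s' - s' + s" using i_ge[of s'] by simp
      then have "p ^ (i s' + 1) dvd p ^ (i s' - s' + s)" by (rule le_imp_power_dvd)
      then show ?thesis unfolding eq by (intro dvdg_zs_dvd) (simp only: of_nat_dvd_iff)
    next
      case False
      then have "i s + 1 \<le> i s' - s' + s" using i_gap[of s s'] \<open>s \<noteq> s'\<close> i_ge[of s'] by simp
      then have "p ^ (i s + 1) dvd p ^ (i s' - s' + s)" by (rule le_imp_power_dvd)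
      then obtain n where "p ^ (i s' - s' + s) = n * p ^ (i s + 1)" by (metis dvd_div_mult_self)
      then have "zs (int (p ^ (i s' - s' + s))) (x s r) = zs (int n) (zs (int (p ^ (i s + 1))) (x s r))"
        by (simp only: of_nat_mult zs.scale_scale)
      then show ?thesis unfolding eq x(1) by simp
    qed
  qed
qed

section \<open>The equivalence\<close>

theorem theorem5p23:
  assumes "infinite (UNIV :: 'a::ab_group_add set)"
  shows "(vc_fun TYPE('a) 1 < \<infinity> \<longleftrightarrow> (\<forall>m. vc_fun TYPE('a) m < \<infinity>)) \<and>
    ((\<forall>m. vc_fun TYPE('a) m < \<infinity>) \<longleftrightarrow>
      (\<exists>d::nat. \<forall>m. vc_fun TYPE('a) m \<le> ereal (real (d * m)))) \<and>
    ((\<exists>d::nat. \<forall>m. vc_fun TYPE('a) m \<le> ereal (real (d * m))) \<longleftrightarrow>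
      finite {p. singular_prime TYPE('a) p} \<and>
      (\<forall>p. prime p \<longrightarrow> finite (U_infinite TYPE('a) p)))"
proof -
  let ?inv = "finite {p. singular_prime TYPE('a) p} \<and>
      (\<forall>p. prime p \<longrightarrow> finite (U_infinite TYPE('a) p))"
  \<comment> \<open>A nonzero element is required for the selector coordinates.\<close>
  have "\<exists>a1 :: 'a. a1 \<noteq> 0"
  proof (rule ccontr)
    assume "\<not> ?thesis"
    then have "(UNIV :: 'a set) = {0}" by auto
    then show False using assms by (metis finite.emptyI finite_insert)
  qed
  then obtain a1 :: 'a where a1: "a1 \<noteq> 0" by blast
  \<comment> \<open>From (1) to (4): each way for (4) to fail pushes the VC density in one parameter
    above every \<open>D\<close>.\<close>
  have "?inv" if vc_finite: "vc_fun TYPE('a) 1 < \<infinity>"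
  proof (rule ccontr)
    assume "\<not> ?inv"
    then consider "infinite {p. singular_prime TYPE('a) p}" | p where "infinite (U_infinite TYPE('a) p)"
      by blast
    then have "ereal (real D) \<le> vc_fun TYPE('a) 1" for D
    proof cases
      case 1
      have "{p. singular_prime TYPE('a) p} =
          {p. prime p \<and> infinite (torsion_part p (UNIV :: 'a set))} \<union>
          {p. prime p \<and> infinite (cosets (UNIV :: 'a set) (range (nsmul p)))}"
        by (auto simp: singular_prime_def)
      then consider "infinite {p. prime p \<and> infinite (torsion_part p (UNIV :: 'a set))}"
        | "infinite {p. prime p \<and> infinite (cosets (UNIV :: 'a set) (range (nsmul p)))}"
        using 1 finite_Un by auto
      then show ?thesis
        using vc_fun_1_ge_of_torsion[OF a1] vc_fun_1_ge_of_quotients[OF a1] by cases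
    next
      case 2
      then show ?thesis by (rule vc_fun_1_ge_of_ulm[OF a1])
    qed
    moreover obtain D where "vc_fun TYPE('a) 1 < ereal (real D)"
      using less_imp_neq[OF vc_finite] unfolding less_PInf_Ex_of_nat by blast
    ultimately show False using leD by blast
  qed
  \<comment> \<open>From (4) to (3): the breadth bound for one-dimensional fibres serves as the
    slope \<open>d\<close>.\<close>
  moreover have "\<exists>d::nat. \<forall>m. vc_fun TYPE('a) m \<le> ereal (real (d * m))" if inv: "?inv"
  proof -
    obtain d where d: "\<And>v I. finite I \<Longrightarrow> \<forall>H\<in>I. pp H \<Longrightarrow>
        irredundant (supp {v} :: (nat \<Rightarrow> 'a) set) I (\<lambda>H. H) \<Longrightarrow> card I \<le> d"
      using fibre_breadth[OF conjunct1[OF inv] conjunct2[OF inv]] by blast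
    have "vc_fun TYPE('a) m \<le> ereal (real (d * m))" for m by (rule vc_fun_le) (rule d)
    then show ?thesis by blast
  qed
  moreover have "vc_fun TYPE('a) m < \<infinity>"
    if "\<forall>m. vc_fun TYPE('a) m \<le> ereal (real (d * m))" for d m
    using order.strict_trans1[OF that[rule_format, of m], of \<infinity>] by simp
  ultimately show ?thesis by blast
qed

end
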